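(* For every $p\in\mathcal A_+$ and every $\ell\in\mathbb Z_+$, $$\mu_\ell(p)=\langle0|\,p\,|\ell\rangle .$$
   Context: $\mathbb Z_+=\{0,1,2,\dots\}$, $t$ an indeterminate. Let $\widehat Q_0,\widehat Q_1$ be invertible with $\widehat Q_0\widehat Q_1=t\,\widehat Q_1\widehat Q_0$, and define $\widehat Q_j$ ($j\in\mathbb Z$) by the $A_1$ quantum $Q$-system $t\,\widehat Q_{j+1}\widehat Q_{j-1}=\widehat Q_j^2-1$; then $\widehat Q_j\widehat Q_{j+1}=t\,\widehat Q_{j+1}\widehat Q_j$ and all $\widehat Q_j$ lie in the quantum torus $\mathbb Z[t^{\pm1}]\langle\widehat Q_0^{\pm1},\widehat Q_1^{\pm1}\rangle$. Let $\mathcal A_+$ be the $\mathbb Z[t^{\pm1}]$-algebra generated by $\widehat Q_0,\widehat Q_0^{-1},\widehat Q_m$ ($m\ge1$), viewed inside this quantum torus. Definition of $\mu_\ell$: work in the ring of formal Laurent series in $\widehat Q_1^{-1}$ with coefficients Laurent polynomials in $\widehat Q_0$. For a series in normal-ordered form $f=\sum_{a,b}f_{a,b}\widehat Q_0^a\widehat Q_1^b$, $\mathrm{CT}_{\widehat Q_1}(f)|_{\widehat Q_0=1}=\sum_af_{a,0}$. Let $z=\lim_{k\to\infty}\widehat Q_k\widehat Q_{k+1}^{-1}=\widehat Q_0\widehat Q_1^{-1}\prod_{k=1}^\infty(1-\widehat Q_k^{-2})^{-1}$ (factors ordered with $k$ increasing to the right). Then $$\mu_\ell(p)=\mathrm{CT}_{\widehat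 Q_1}\big(\widehat Q_1\widehat Q_0^{-1}\,p\,z^{\ell+1}\big)\big|_{\widehat Q_0=1}.$$ Definition of the representation: a cyclic representation of $\mathcal A_+$ (acting from the right) with cyclic vector $\langle0|$ and $\mathbb Z[t^{\pm1}]$-basis $\langle m|$, $m\in\mathbb Z_+$, such that $\langle0|\widehat Q_0=t^{-1}\langle0|$ and $\langle m|=t^{m+1}\langle0|\widehat Q_m$ for $m>0$. $|\ell\rangle$, $\ell\in\mathbb Z_+$, is the dual basis: $\langle m|\ell\rangle=\delta_{m,\ell}$. *)

theory Defs
  imports "HOL-Library.Poly_Mapping" "HOL.Modules"
begin

section \<open>The skew ring of Laurent series in the inverse of the second generator\<close>

text \<open>Finitely supported functions on the exponents, with the convolution product of
  \<^theory>\<open>HOL-Library.Poly_Mapping\<close>, are Laurent polynomials.\<close>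

type_synonym laurent_t = "int \<Rightarrow>\<^sub>0 int"
type_synonym laurent_tq = "int \<Rightarrow>\<^sub>0 laurent_t"

definition tpow :: "int \<Rightarrow> laurent_t"
  where "tpow k = Poly_Mapping.single k 1"

lemma tpow_add: "tpow (a + b) = tpow a * tpow b"
  by (simp add: tpow_def mult_single)

lemma tpow_0 [simp]: "tpow 0 = 1"
  by (simp add: tpow_def)

lemma tpow_neq_0 [simp]: "tpow k \<noteq> 0"
  by (metis lookup_single_eq lookup_zero tpow_def zero_neq_one)

lemma tpow_eq_iff: "tpow a = tpow b \<longleftrightarrow> a = b"
  by (metis lookup_single_eq lookup_single_not_eq tpow_def zero_neq_one)

text \<open>Conjugation of a Laurent polynomial in \<open>Q\<^sub>0\<close> by \<open>Q\<^sub>1 ^ n\<close>: since \<open>Q\<^sub>0 Q\<^sub>1 = t Q\<^sub>1 Q\<^sub>0\<close>,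
  one has \<open>Q\<^sub>1 ^ n Q\<^sub>0 ^ a = t ^ (- n a) Q\<^sub>0 ^ a Q\<^sub>1 ^ n\<close>.\<close>

definition twist :: "int \<Rightarrow> laurent_tq \<Rightarrow> laurent_tq"
  where "twist n p = Poly_Mapping.mapp (\<lambda>a c. tpow (- n * a) * c) p"

lemma lookup_twist: "Poly_Mapping.lookup (twist n p) a = tpow (- n * a) * Poly_Mapping.lookup p a"
  by (auto simp: twist_def mapp.rep_eq when_def in_keys_iff)

lemma twist_add: "twist n (p + q) = twist n p + twist n q"
  by (rule poly_mapping_eqI) (simp add: lookup_twist lookup_add algebra_simps)

lemma twist_0 [simp]: "twist n 0 = 0"
  by (rule poly_mapping_eqI) (simp add: lookup_twist)

lemma twist_id [simp]: "twist 0 p = p"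
  by (rule poly_mapping_eqI) (simp add: lookup_twist)

lemma twist_twist: "twist m (twist n p) = twist (m + n) p"
proof (rule poly_mapping_eqI)
  fix a
  have "- (m + n) * a = (- m * a) + (- n * a)" by (simp add: algebra_simps)
  then have "tpow (- (m + n) * a) = tpow (- m * a) * tpow (- n * a)" by (simp only: tpow_add)
  then show "Poly_Mapping.lookup (twist m (twist n p)) a = Poly_Mapping.lookup (twist (m + n) p) a"
    by (simp only: lookup_twist mult.assoc)
qed

lemma twist_single: "twist n (Poly_Mapping.single a c) = Poly_Mapping.single a (tpow (- n * a) * c)"
  by (rule poly_mapping_eqI) (auto simp: lookup_twist lookup_single when_def)

lemma twist_sum: "twist n (sum f A) = (\<Sum>x\<in>A. twist n (f x))"
  by (induction A rule: infinite_finite_induct) (auto simp: twist_add)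

lemma twist_eq_0_iff [simp]: "twist n p = 0 \<longleftrightarrow> p = 0"
  by (metis twist_0 twist_id twist_twist add.left_inverse)

lemma lookup_times_int:
  fixes p q :: laurent_tq
  shows "Poly_Mapping.lookup (p * q) k = (\<Sum>l. Poly_Mapping.lookup p l * Poly_Mapping.lookup q (k - l))"
proof -
  have "(\<Sum>r. (Poly_Mapping.lookup q r when k = l + r)) = Poly_Mapping.lookup q (k - l)" for l
  proof -
    have *: "(\<lambda>r. (Poly_Mapping.lookup q r when k = l + r)) = (\<lambda>r. (Poly_Mapping.lookup q r when r = k - l))"
      by (auto simp: when_def fun_eq_iff)
    show ?thesis unfolding * by (rule Sum_any_when_equal)
  qed
  then show ?thesis by (simp add: lookup_mult)
qed

lemma twist_mult: "twist n (p * q) = twist n p * twist n q"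
proof (rule poly_mapping_eqI)
  fix k
  have fin: "finite {l. Poly_Mapping.lookup p l * Poly_Mapping.lookup q (k - l) \<noteq> 0}"
    by (rule finite_subset [OF _ finite_lookup [of p]]) auto
  have eq: "tpow (- n * k) * (Poly_Mapping.lookup p l * Poly_Mapping.lookup q (k - l))
      = tpow (- n * l) * Poly_Mapping.lookup p l * (tpow (- n * (k - l)) * Poly_Mapping.lookup q (k - l))" for l
  proof -
    have "- n * k = (- n * l) + (- n * (k - l))" by (simp add: algebra_simps)
    then have "tpow (- n * k) = tpow (- n * l) * tpow (- n * (k - l))" by (simp only: tpow_add)
    then show ?thesis by (simp only: mult.assoc mult.left_commute mult.commute)
  qed
  show "Poly_Mapping.lookup (twist n (p * q)) k = Poly_Mapping.lookup (twist n p * twist n q) k"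
    unfolding lookup_twist lookup_times_int Sum_any_right_distrib [OF fin] eq ..
qed

text \<open>An element \<open>f\<close> stands for the normal-ordered series \<open>\<Sum>a b. f b a Q\<^sub>0 ^ a Q\<^sub>1 ^ b\<close>.\<close>

typedef qseries = "{f :: int \<Rightarrow> laurent_tq. \<exists>N. \<forall>b>N. f b = 0}"
  morphisms coeff Abs_qseries
  by (rule exI [of _ "\<lambda>_. 0"]) simp

setup_lifting type_definition_qseries

lemma qseries_eqI: "(\<And>b. coeff f b = coeff g b) \<Longrightarrow> f = g"
  by (simp add: coeff_inject [symmetric] fun_eq_iff)

lemma coeff_bound: obtains N where "\<And>b. b > N \<Longrightarrow> coeff f b = 0"
  using coeff [of f] by auto

lemma Sum_any_box:
  fixes f g :: "int \<Rightarrow> laurent_tq"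
  assumes "\<And>b. b > M \<Longrightarrow> f b = 0" "\<And>b. b > N \<Longrightarrow> g b = 0" "finite S" "{n - N..M} \<subseteq> S"
  shows "(\<Sum>i. f i * twist i (g (n - i))) = (\<Sum>i\<in>S. f i * twist i (g (n - i)))"
proof (rule Sum_any.expand_superset)
  show "{i. f i * twist i (g (n - i)) \<noteq> 0} \<subseteq> S"
  proof
    fix i assume "i \<in> {i. f i * twist i (g (n - i)) \<noteq> 0}"
    then have "f i \<noteq> 0" "g (n - i) \<noteq> 0" by auto
    then have "i \<le> M" "n - i \<le> N" using assms(1,2) by (meson not_le)+
    then show "i \<in> S" using assms(4) by auto
  qed
qed (fact assms)

instantiation qseries :: ring_1
begin

lift_definition zero_qseries :: qseries is "\<lambda>_. 0" by simp

lift_definition one_qseries :: qseries is "\<lambda>b. 1 when b = 0"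
  by (rule exI [of _ 0]) simp

lift_definition plus_qseries :: "qseries \<Rightarrow> qseries \<Rightarrow> qseries" is "\<lambda>f g b. f b + g b"
proof -
  fix f g :: "int \<Rightarrow> laurent_tq"
  assume "\<exists>N. \<forall>b>N. f b = 0" "\<exists>N. \<forall>b>N. g b = 0"
  then obtain M N where "\<forall>b>M. f b = 0" "\<forall>b>N. g b = 0" by auto
  then show "\<exists>N. \<forall>b>N. f b + g b = 0" by (intro exI [of _ "max M N"]) auto
qed

lift_definition uminus_qseries :: "qseries \<Rightarrow> qseries" is "\<lambda>f b. - f b" by simp

definition minus_qseries :: "qseries \<Rightarrow> qseries \<Rightarrow> qseries"
  where "minus_qseries f g = f + - g"

lift_definition times_qseries :: "qseries \<Rightarrow> qseries \<Rightarrow> qseries"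
  is "\<lambda>f g n. \<Sum>i. f i * twist i (g (n - i))"
proof -
  fix f g :: "int \<Rightarrow> laurent_tq"
  assume "\<exists>N. \<forall>b>N. f b = 0" "\<exists>N. \<forall>b>N. g b = 0"
  then obtain M N where *: "\<And>b. b > M \<Longrightarrow> f b = 0" "\<And>b. b > N \<Longrightarrow> g b = 0" by auto
  have "(\<Sum>i. f i * twist i (g (n - i))) = 0" if "n > M + N" for n
    using Sum_any_box [of M f N g "{n - N..M}" n, OF *] that by simp
  then show "\<exists>N. \<forall>n>N. (\<Sum>i. f i * twist i (g (n - i))) = 0" by blast
qed

lemma coeff_mult_box:
  assumes "\<And>b. b > M \<Longrightarrow> coeff f b = 0" "\<And>b. b > N \<Longrightarrow> coeff g b = 0"
    "finite S" "{n - N..M} \<subseteq> S"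
  shows "coeff (f * g) n = (\<Sum>i\<in>S. coeff f i * twist i (coeff g (n - i)))"
  using Sum_any_box [OF assms] by (simp add: times_qseries.rep_eq)

instance
proof
  fix f g h :: qseries
  show "f + g + h = f + (g + h)" "f + g = g + f" "0 + f = f" "- f + f = 0" "f - g = f + - g"
    by (auto intro!: qseries_eqI
        simp: minus_qseries_def plus_qseries.rep_eq uminus_qseries.rep_eq zero_qseries.rep_eq algebra_simps)
  have "coeff 0 0 \<noteq> coeff 1 0" by (simp add: zero_qseries.rep_eq one_qseries.rep_eq)
  then show "(0::qseries) \<noteq> 1" by metis
  obtain M where M: "\<And>b. b > M \<Longrightarrow> coeff f b = 0" using coeff_bound [of f] by blast
  obtain N where N: "\<And>b. b > N \<Longrightarrow> coeff g b = 0" using coeff_bound [of g] by blast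
  obtain P where P: "\<And>b. b > P \<Longrightarrow> coeff h b = 0" using coeff_bound [of h] by blast
  have fg: "coeff (f * g) b = 0" if "b > M + N" for b
    using coeff_mult_box [of M f N g "{b - N..M}" b, OF M N] that by simp
  have gh: "coeff (g * h) b = 0" if "b > N + P" for b
    using coeff_mult_box [of N g P h "{b - P..N}" b, OF N P] that by simp
  show "f * g * h = f * (g * h)"
  proof (rule qseries_eqI)
    fix n
    define I where "I = {n - N - P..M}"
    define J where "J = {n - P..M + N}"
    have "coeff (f * g * h) n = (\<Sum>j\<in>J. coeff (f * g) j * twist j (coeff h (n - j)))"
      by (rule coeff_mult_box [OF fg P]) (auto simp: J_def)
    also have "\<dots> = (\<Sum>j\<in>J. \<Sum>i\<in>I. coeff f i * twist i (coeff g (j - i)) * twist j (coeff h (n - j)))"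
    proof (rule sum.cong)
      fix j assume "j \<in> J"
      then have "coeff (f * g) j = (\<Sum>i\<in>I. coeff f i * twist i (coeff g (j - i)))"
        by (intro coeff_mult_box [OF M N]) (auto simp: I_def J_def)
      then show "coeff (f * g) j * twist j (coeff h (n - j))
          = (\<Sum>i\<in>I. coeff f i * twist i (coeff g (j - i)) * twist j (coeff h (n - j)))"
        by (simp add: sum_distrib_right)
    qed simp
    also have "\<dots> = (\<Sum>i\<in>I. \<Sum>j\<in>J. coeff f i * twist i (coeff g (j - i)) * twist j (coeff h (n - j)))"
      by (rule sum.swap)
    also have "\<dots> = (\<Sum>i\<in>I. coeff f i * twist i (coeff (g * h) (n - i)))"
    proof (rule sum.cong)
      fix i assume "i \<in> I"
      have "coeff (g * h) (n - i)
          = (\<Sum>k\<in>(\<lambda>j. j - i) ` J. coeff g k * twist k (coeff h (n - i - k)))"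
        by (intro coeff_mult_box [OF N P]) (use \<open>i \<in> I\<close> in \<open>auto simp: I_def J_def\<close>)
      also have "\<dots> = (\<Sum>j\<in>J. coeff g (j - i) * twist (j - i) (coeff h (n - j)))"
        by (subst sum.reindex) (auto simp: inj_on_def)
      finally show "(\<Sum>j\<in>J. coeff f i * twist i (coeff g (j - i)) * twist j (coeff h (n - j)))
          = coeff f i * twist i (coeff (g * h) (n - i))"
        by (simp add: twist_sum twist_mult twist_twist sum_distrib_left mult.assoc)
    qed simp
    also have "\<dots> = coeff (f * (g * h)) n"
      by (rule coeff_mult_box [OF M gh, symmetric]) (auto simp: I_def)
    finally show "coeff (f * g * h) n = coeff (f * (g * h)) n" .
  qed
  show "(f + g) * h = f * h + g * h"
  proof (rule qseries_eqI)
    fix n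
    have MN: "coeff (f + g) b = 0" if "b > max M N" for b
      using M N that by (simp add: plus_qseries.rep_eq)
    show "coeff ((f + g) * h) n = coeff (f * h + g * h) n"
      using coeff_mult_box [of "max M N" "f + g" P h "{n - P..max M N}" n, OF MN P]
        coeff_mult_box [of M f P h "{n - P..max M N}" n, OF M P]
        coeff_mult_box [of N g P h "{n - P..max M N}" n, OF N P]
      by (simp add: plus_qseries.rep_eq sum.distrib distrib_right)
  qed
  show "f * (g + h) = f * g + f * h"
  proof (rule qseries_eqI)
    fix n
    have NP: "coeff (g + h) b = 0" if "b > max N P" for b
      using N P that by (simp add: plus_qseries.rep_eq)
    show "coeff (f * (g + h)) n = coeff (f * g + f * h) n"
      using coeff_mult_box [of M f "max N P" "g + h" "{n - max N P..M}" n, OF M NP]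
        coeff_mult_box [of M f N g "{n - max N P..M}" n, OF M N]
        coeff_mult_box [of M f P h "{n - max N P..M}" n, OF M P]
      by (simp add: plus_qseries.rep_eq sum.distrib distrib_left twist_add)
  qed
  show "1 * f = f"
  proof (rule qseries_eqI)
    fix n
    show "coeff (1 * f) n = coeff f n"
      by (simp add: times_qseries.rep_eq one_qseries.rep_eq when_mult)
  qed
  have tw1: "twist i 1 = 1" for i
    using twist_single [of i 0 1] by simp
  show "f * 1 = f"
  proof (rule qseries_eqI)
    fix n
    have "coeff f i * twist i (1 when n - i = 0) = (coeff f i when i = n)" for i
      by (auto simp: when_def tw1)
    then have "coeff (f * 1) n = (\<Sum>i. (coeff f i when i = n))"
      by (simp only: times_qseries.rep_eq one_qseries.rep_eq)
    then show "coeff (f * 1) n = coeff f n" by simp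
  qed
qed

end

lemma coeff_0 [simp]: "coeff 0 b = 0"
  and coeff_1: "coeff 1 b = (1 when b = 0)"
  and coeff_add [simp]: "coeff (f + g) b = coeff f b + coeff g b"
  and coeff_uminus [simp]: "coeff (- f) b = - coeff f b"
  by (simp_all add: zero_qseries.rep_eq one_qseries.rep_eq plus_qseries.rep_eq
      uminus_qseries.rep_eq)

lemma coeff_diff [simp]: "coeff (f - g) b = coeff f b - coeff g b"
  unfolding minus_qseries_def by (simp del: add_uminus_conv_diff)

text \<open>\<open>deg_le f N\<close>: the degree of \<open>f\<close> in \<open>Q\<^sub>1\<close> is at most \<open>N\<close>.\<close>

definition deg_le :: "qseries \<Rightarrow> int \<Rightarrow> bool"
  where "deg_le f N \<longleftrightarrow> (\<forall>b>N. coeff f b = 0)"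

lemma deg_le_mult: "deg_le f M \<Longrightarrow> deg_le g N \<Longrightarrow> deg_le (f * g) (M + N)"
  unfolding deg_le_def
proof (intro allI impI)
  fix b assume "\<forall>b>M. coeff f b = 0" "\<forall>b>N. coeff g b = 0" "b > M + N"
  then show "coeff (f * g) b = 0"
    using coeff_mult_box [of M f N g "{b - N..M}" b] by simp
qed

lemma coeff_mult_top:
  assumes "deg_le f M" "deg_le g N"
  shows "coeff (f * g) (M + N) = coeff f M * twist M (coeff g N)"
  using coeff_mult_box [of M f N g "{M}" "M + N"] assms by (simp add: deg_le_def)

lemma deg_le_add: "deg_le f N \<Longrightarrow> deg_le g N \<Longrightarrow> deg_le (f + g) N"
  and deg_le_diff: "deg_le f N \<Longrightarrow> deg_le g N \<Longrightarrow> deg_le (f - g) N"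
  and deg_le_mono: "deg_le f N \<Longrightarrow> N \<le> M \<Longrightarrow> deg_le f M"
  by (auto simp: deg_le_def)

lemma deg_le_exists: obtains N where "deg_le f N"
  using coeff_bound [of f] unfolding deg_le_def by blast

lemma top_degree:
  assumes "f \<noteq> 0"
  obtains N where "deg_le f N" "coeff f N \<noteq> 0"
proof -
  obtain M where M: "deg_le f M" using deg_le_exists [of f] by blast
  obtain b where b: "coeff f b \<noteq> 0" using assms by (metis qseries_eqI coeff_0)
  then have bM: "b \<le> M" using M by (auto simp: deg_le_def not_less [symmetric])
  define S where "S = {i \<in> {b..M}. coeff f i \<noteq> 0}"
  have "finite S" by (rule finite_subset [of _ "{b..M}"]) (auto simp: S_def)
  moreover have "b \<in> S" using b bM by (auto simp: S_def)
  ultimately have S: "finite S" "b \<in> S" by auto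
  have "coeff f (Max S) \<noteq> 0" using Max_in [of S] S by (auto simp: S_def)
  moreover have "coeff f i = 0" if "i > Max S" for i
  proof (rule ccontr)
    assume "coeff f i \<noteq> 0"
    moreover have "i \<ge> b" using that Max_ge [OF S] by linarith
    ultimately have "i \<in> S" using M by (force simp: S_def deg_le_def not_less [symmetric])
    then show False using that Max_ge [OF S(1), of i] by linarith
  qed
  ultimately show ?thesis using that by (auto simp: deg_le_def)
qed

instance qseries :: ring_1_no_zero_divisors
proof
  fix f g :: qseries
  assume "f \<noteq> 0" "g \<noteq> 0"
  obtain M where M: "deg_le f M" "coeff f M \<noteq> 0" using \<open>f \<noteq> 0\<close> by (rule top_degree)
  obtain N where N: "deg_le g N" "coeff g N \<noteq> 0" using \<open>g \<noteq> 0\<close> by (rule top_degree)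
  have "coeff (f * g) (M + N) \<noteq> 0"
    using M N by (simp add: coeff_mult_top)
  then show "f * g \<noteq> 0" by auto
qed

text \<open>\<open>qmono c a b = c Q\<^sub>0 ^ a Q\<^sub>1 ^ b\<close>\<close>

definition qmono :: "laurent_t \<Rightarrow> int \<Rightarrow> int \<Rightarrow> qseries"
  where "qmono c a b = Abs_qseries (\<lambda>b'. Poly_Mapping.single a c when b' = b)"

lemma coeff_qmono: "coeff (qmono c a b) b' = (Poly_Mapping.single a c when b' = b)"
  unfolding qmono_def by (subst Abs_qseries_inverse) (auto simp: when_def)

lemma deg_le_qmono: "deg_le (qmono c a b) b"
  by (auto simp: deg_le_def coeff_qmono)

lemma qmono_mult:
  "qmono c a b * qmono d a' b' = qmono (tpow (- b * a') * c * d) (a + a') (b + b')"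
proof (rule qseries_eqI)
  fix n
  have "coeff (qmono c a b * qmono d a' b') n
      = (\<Sum>i. (Poly_Mapping.single a c * twist b (Poly_Mapping.single a' d when n - b = b') when i = b))"
    unfolding times_qseries.rep_eq coeff_qmono by (rule Sum_any.cong) (simp add: when_def)
  also have "\<dots> = (Poly_Mapping.single a c * twist b (Poly_Mapping.single a' d) when n = b + b')"
    by (auto simp: when_def)
  also have "\<dots> = coeff (qmono (tpow (- b * a') * c * d) (a + a') (b + b')) n"
    by (simp add: coeff_qmono twist_single mult_single mult_ac)
  finally show "coeff (qmono c a b * qmono d a' b') n
      = coeff (qmono (tpow (- b * a') * c * d) (a + a') (b + b')) n" .
qed

lemma qmono_1 [simp]: "qmono 1 0 0 = 1"
  by (rule qseries_eqI) (simp add: coeff_qmono coeff_1)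

lemma qmono_uminus: "qmono (- c) a b = - qmono c a b"
  by (rule qseries_eqI) (simp add: coeff_qmono when_def single_uminus)

definition scalar :: "laurent_t \<Rightarrow> qseries"
  where "scalar c = qmono c 0 0"

lemma scalar_central: "scalar c * f = f * scalar c"
proof (rule qseries_eqI)
  fix n
  have "coeff (scalar c * f) n = (\<Sum>i. (Poly_Mapping.single 0 c * coeff f n when i = (0::int)))"
    unfolding times_qseries.rep_eq scalar_def coeff_qmono by (rule Sum_any.cong) (simp add: when_def)
  moreover have "coeff (f * scalar c) n = (\<Sum>i. (coeff f n * twist n (Poly_Mapping.single 0 c) when i = n))"
    unfolding times_qseries.rep_eq scalar_def coeff_qmono by (rule Sum_any.cong) (simp add: when_def)
  ultimately show "coeff (scalar c * f) n = coeff (f * scalar c) n"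
    by (simp add: twist_single mult.commute)
qed


section \<open>The quantum Q-system and the algebra\<close>

definition q0 :: qseries where "q0 = qmono 1 1 0"
definition q0_inv :: qseries where "q0_inv = qmono 1 (- 1) 0"
definition q1 :: qseries where "q1 = qmono 1 0 1"
definition q1_inv :: qseries where "q1_inv = qmono 1 0 (- 1)"

abbreviation tq :: qseries where "tq \<equiv> scalar (tpow 1)"
abbreviation tq_inv :: qseries where "tq_inv \<equiv> scalar (tpow (- 1))"

lemma q0_q1: "q0 * q1 = tq * q1 * q0"
  by (simp add: q0_def q1_def scalar_def qmono_mult flip: tpow_add)

lemma q0_inverse: "q0 * q0_inv = 1" "q0_inv * q0 = 1"
  and q1_inverse: "q1 * q1_inv = 1" "q1_inv * q1 = 1"
  and tq_inverse: "tq * tq_inv = 1" "tq_inv * tq = 1"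
  by (simp_all add: q0_def q0_inv_def q1_def q1_inv_def scalar_def qmono_mult flip: tpow_add)

text \<open>The quantum torus consists of the elements with finitely many monomials.\<close>

definition quantum_torus :: "qseries set"
  where "quantum_torus = {f. finite {b. coeff f b \<noteq> 0}}"

definition is_Q_system :: "(int \<Rightarrow> qseries) \<Rightarrow> bool"
  where "is_Q_system Q \<longleftrightarrow> Q 0 = q0 \<and> Q 1 = q1 \<and>
    (\<forall>j. tq * Q (j + 1) * Q (j - 1) = (Q j)\<^sup>2 - 1)"

text \<open>Uniqueness holds because the ring has no zero divisors. For existence one solves the
  linear recursion whose constant coefficient is the following conserved quantity.\<close>

definition conserved :: qseries
  where "conserved = (tq_inv * (q1\<^sup>2 - 1) * q0_inv + tq * q0) * q1_inv"

lemma int_const: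
  fixes f :: "int \<Rightarrow> 'a"
  assumes "\<And>j. f (j + 1) = f j"
  shows "f j = f 0"
proof (induction j rule: int_induct [where k = 0])
  case (step2 i)
  then show ?case using assms [of "i - 1"] by simp
qed (use assms in auto)

lemma tq_left [simp]: "tq_inv * (tq * x) = x" "tq * (tq_inv * x) = x"
  by (simp_all add: mult.assoc [symmetric] tq_inverse)

lemma tq_neq_0: "tq \<noteq> 0"
  using tq_inverse by auto

lemma linear_recursion_ex:
  "\<exists>Q :: int \<Rightarrow> qseries. Q 0 = q0 \<and> Q 1 = q1 \<and>
    (\<forall>j. conserved * Q j = Q (j + 1) + tq * Q (j - 1))"
proof -
  define s where "s = (\<lambda>(x, y). (y, conserved * y - tq * x))"
  define r where "r = (\<lambda>(x, y). (tq_inv * (conserved * x - y), x))"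
  have sr: "s (r p) = p" for p
    by (cases p) (simp add: s_def r_def)
  define P where "P j = (if j \<ge> 0 then (s ^^ nat j) (q0, q1) else (r ^^ nat (- j)) (q0, q1))" for j :: int
  have step: "P (j + 1) = s (P j)" for j
  proof (cases "j \<ge> 0")
    case True
    then have "nat (j + 1) = Suc (nat j)" by simp
    with True show ?thesis by (simp add: P_def)
  next
    case False
    then have *: "nat (- j) = Suc (nat (- (j + 1)))" by simp
    have "P (j + 1) = (r ^^ nat (- (j + 1))) (q0, q1)"
      using False by (cases "j = - 1") (auto simp: P_def)
    moreover have "P j = r ((r ^^ nat (- (j + 1))) (q0, q1))"
      using False by (simp only: P_def * funpow.simps o_apply) simp
    ultimately show ?thesis by (simp only: sr)
  qed
  define Q where "Q j = fst (P j)" for j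
  have s1: "Q (j + 1) = snd (P j)" for j by (simp add: Q_def step s_def case_prod_beta)
  have "Q (j + 1 + 1) = conserved * Q (j + 1) - tq * Q j" for j
    unfolding s1 step by (simp add: s_def Q_def case_prod_beta)
  from this [of "j - 1" for j] have "conserved * Q j = Q (j + 1) + tq * Q (j - 1)" for j by simp
  moreover have "Q 0 = q0" by (simp add: Q_def P_def)
  moreover have "Q 1 = q1" using s1 [of 0] by (simp add: P_def)
  ultimately show ?thesis by blast
qed

lemma linear_recursion_0:
  fixes e :: "int \<Rightarrow> qseries"
  assumes rec: "\<And>j. conserved * e j = e (j + 1) + tq * e (j - 1)" and "e 0 = 0" "e 1 = 0"
  shows "e j = 0"
proof -
  have "e j = 0 \<and> e (j + 1) = 0"
  proof (induction j rule: int_induct [where k = 0])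
    case base
    then show ?case using assms by simp
  next
    case (step1 i)
    then show ?case using rec [of "i + 1"] by simp
  next
    case (step2 i)
    then show ?case using rec [of i] tq_neq_0 by simp
  qed
  then show ?thesis by simp
qed

lemma conserved_monomials:
  "conserved = qmono (tpow 1) (- 1) 1 - qmono (tpow (- 1)) (- 1) (- 1) + qmono (tpow 1) 1 (- 1)"
  by (simp add: conserved_def q0_def q0_inv_def q1_def q1_inv_def scalar_def power2_eq_square
      algebra_simps qmono_mult flip: tpow_add)

lemma linear_recursion_Q_system:
  assumes Q0: "Q 0 = q0" and Q1: "Q 1 = q1"
    and rec: "\<And>j. conserved * Q j = Q (j + 1) + tq * Q (j - 1)"
  shows "is_Q_system Q" "Q j * Q (j + 1) = tq * Q (j + 1) * Q j"
proof -
  let ?C = conserved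
  note tq_comm = scalar_central [of "tpow 1" "Q i" for i, symmetric]
    scalar_central [of "tpow 1" ?C, symmetric]
  have tq_left_comm: "Q i * (tq * x) = tq * (Q i * x)" "?C * (tq * x) = tq * (?C * x)" for i x
    by (metis mult.assoc scalar_central)+
  have Q2: "Q 2 = ?C * q1 - tq * q0" using rec [of 1] Q0 Q1 by simp
  have Qm1: "tq * Q (- 1) = ?C * q0 - q1" using rec [of 0] Q0 Q1 by (simp add: algebra_simps)
  define e where "e j = Q j * ?C - tq * Q (j + 1) - Q (j - 1)" for j
  have "?C * e j = e (j + 1) + tq * e (j - 1)" for j
  proof -
    have "?C * e j = (?C * Q j) * ?C - tq * (?C * Q (j + 1)) - ?C * Q (j - 1)"
      by (simp add: e_def right_diff_distrib tq_left_comm mult.assoc)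
    also have "\<dots> = e (j + 1) + tq * e (j - 1)"
      unfolding rec by (simp add: e_def algebra_simps)
    finally show ?thesis .
  qed
  moreover have "e 0 = 0"
  proof -
    have "tq * e 0 = tq * (q0 * ?C) - tq * (tq * q1) - tq * Q (- 1)"
      by (simp add: e_def Q0 Q1 right_diff_distrib)
    also have "\<dots> = 0"
      unfolding Qm1 unfolding conserved_monomials q0_def q1_def scalar_def
      by (simp add: algebra_simps qmono_mult flip: tpow_add)
    finally show ?thesis using tq_neq_0 by simp
  qed
  moreover have "e 1 = 0"
    unfolding e_def
    by (simp add: Q0 Q1 Q2) (simp add: conserved_monomials q0_def q1_def scalar_def
      algebra_simps qmono_mult flip: tpow_add)
  ultimately have "e j = 0" for j by (rule linear_recursion_0)
  then have rec': "Q j * ?C = tq * Q (j + 1) + Q (j - 1)" for j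
    by (simp add: e_def algebra_simps)
  have succ: "Q (j + 2) = ?C * Q (j + 1) - tq * Q j" for j
    using rec [of "j + 1"] by (simp add: algebra_simps)
  have rec'1: "Q (j + 1) * ?C = tq * Q (j + 2) + Q j" for j
    using rec' [of "j + 1"] by (simp add: algebra_simps)
  define a where "a j = Q j * Q (j + 1) - tq * Q (j + 1) * Q j" for j
  have "a (j + 1) = a j" for j
  proof -
    have "Q (j + 1) * Q (j + 2) = (Q (j + 1) * ?C) * Q (j + 1) - tq * Q (j + 1) * Q j"
      unfolding succ by (simp add: right_diff_distrib tq_left_comm mult.assoc)
    also have "\<dots> = tq * Q (j + 2) * Q (j + 1) + Q j * Q (j + 1) - tq * Q (j + 1) * Q j"
      unfolding rec'1 by (simp add: distrib_right)
    finally show ?thesis by (simp add: a_def algebra_simps)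
  qed
  then have "a j = a 0" for j by (rule int_const)
  moreover have "a 0 = 0" by (simp add: a_def Q0 Q1 q0_q1)
  ultimately show "Q j * Q (j + 1) = tq * Q (j + 1) * Q j" by (simp add: a_def)
  define d where "d j = tq * Q (j + 1) * Q (j - 1) - Q j * Q j" for j
  have "d (j + 1) = d j" for j
  proof -
    have "Q (j + 1) * Q (j + 1) = Q (j + 1) * (?C * Q j - tq * Q (j - 1))"
      by (rule arg_cong [where f = "\<lambda>x. Q (j + 1) * x"]) (simp add: rec)
    also have "\<dots> = (Q (j + 1) * ?C) * Q j - tq * (Q (j + 1) * Q (j - 1))"
      by (simp add: right_diff_distrib tq_left_comm mult.assoc)
    also have "\<dots> = tq * Q (j + 2) * Q j + Q j * Q j - tq * (Q (j + 1) * Q (j - 1))"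
      unfolding rec'1 by (simp add: distrib_right)
    finally show ?thesis by (simp add: d_def algebra_simps)
  qed
  then have d: "d j = d 0" for j by (rule int_const)
  have "d 1 = - 1"
    by (simp add: d_def Q0 Q1 Q2) (simp add: conserved_monomials q0_def q1_def scalar_def
      algebra_simps qmono_mult flip: tpow_add)
  then have d': "d j = - 1" for j using d [of 1] d [of j] by simp
  have "tq * Q (j + 1) * Q (j - 1) = (Q j)\<^sup>2 - 1" for j
    using d' [of j] unfolding d_def power2_eq_square by (simp only: diff_eq_eq) simp
  then show "is_Q_system Q" by (simp add: is_Q_system_def Q0 Q1)
qed

lemma tq_neq_pm1: "tq \<noteq> 1" "tq \<noteq> - 1"
proof -
  have "Poly_Mapping.lookup (Poly_Mapping.lookup (coeff tq 0) 0) 0 = 0"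
    by (simp add: scalar_def coeff_qmono tpow_def lookup_single)
  moreover have "Poly_Mapping.lookup (Poly_Mapping.lookup (coeff 1 0) 0) 0 = 1"
    by (simp add: coeff_1)
  ultimately show "tq \<noteq> 1" "tq \<noteq> - 1" by (auto simp del: one_neq_zero)
qed

lemma Q_system_neq_0:
  assumes "is_Q_system Q"
  shows "Q j \<noteq> 0"
proof
  assume "Q j = 0"
  have Q: "tq * Q (i + 1) * Q (i - 1) = (Q i)\<^sup>2 - 1" for i
    using assms by (simp add: is_Q_system_def)
  have "(Q (j + 1))\<^sup>2 = 1" "(Q (j - 1))\<^sup>2 = 1"
    using Q [of "j + 1"] Q [of "j - 1"] \<open>Q j = 0\<close> by simp_all
  then have "Q (j + 1) = 1 \<or> Q (j + 1) = - 1" "Q (j - 1) = 1 \<or> Q (j - 1) = - 1"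
    by (simp_all add: power2_eq_1_iff)
  moreover have "tq * Q (j + 1) * Q (j - 1) = - 1" using Q [of j] \<open>Q j = 0\<close> by simp
  ultimately show False using tq_neq_pm1 by (metis minus_minus mult_minus1_right mult.right_neutral)
qed

lemma Q_system_unique:
  assumes "is_Q_system Q" "is_Q_system Q'"
  shows "Q = Q'"
proof
  fix j
  have Q: "tq * Q (i + 1) * Q (i - 1) = (Q i)\<^sup>2 - 1" "tq * Q' (i + 1) * Q' (i - 1) = (Q' i)\<^sup>2 - 1" for i
    using assms by (simp_all add: is_Q_system_def)
  have "Q j = Q' j \<and> Q (j + 1) = Q' (j + 1)"
  proof (induction j rule: int_induct [where k = 0])
    case base
    then show ?case using assms by (simp add: is_Q_system_def)
  next
    case (step1 i)
    have "tq * Q (i + 2) * Q i = (Q (i + 1))\<^sup>2 - 1" "tq * Q' (i + 2) * Q' i = (Q' (i + 1))\<^sup>2 - 1"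
      using Q [of "i + 1"] by (simp_all add: add.assoc)
    then have "tq * Q (i + 2) * Q i = tq * Q' (i + 2) * Q i"
      using step1 by (simp only: conj_assoc)
    then have "Q (i + 2) = Q' (i + 2)"
      using Q_system_neq_0 [OF assms(1), of i] tq_neq_0 by simp
    then show ?case using step1 by (simp add: add.assoc)
  next
    case (step2 i)
    then have "tq * Q (i + 1) * Q (i - 1) = tq * Q (i + 1) * Q' (i - 1)"
      using Q [of i] by simp
    then have "Q (i - 1) = Q' (i - 1)"
      using Q_system_neq_0 [OF assms(1), of "i + 1"] tq_neq_0 by simp
    then show ?case using step2 by simp
  qed
  then show "Q j = Q' j" ..
qed

lemma Q_system_ex1: "\<exists>!Q. is_Q_system Q"
  using linear_recursion_ex linear_recursion_Q_system(1) Q_system_unique by metis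

definition Qhat :: "int \<Rightarrow> qseries"
  where "Qhat = (THE Q. is_Q_system Q)"

lemma Qhat_Q_system: "is_Q_system Qhat"
  unfolding Qhat_def by (rule theI' [OF Q_system_ex1])

lemma Qhat_0 [simp]: "Qhat 0 = q0" and Qhat_1 [simp]: "Qhat 1 = q1"
  and Qhat_rec: "tq * Qhat (j + 1) * Qhat (j - 1) = (Qhat j)\<^sup>2 - 1"
  using Qhat_Q_system by (simp_all add: is_Q_system_def)

lemma Qhat_linear: "conserved * Qhat j = Qhat (j + 1) + tq * Qhat (j - 1)"
  using linear_recursion_ex linear_recursion_Q_system(1) Q_system_unique Qhat_Q_system by metis

lemma Qhat_commute: "Qhat j * Qhat (j + 1) = tq * Qhat (j + 1) * Qhat j"
  by (rule linear_recursion_Q_system(2)) (simp_all add: Qhat_linear)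

lemma quantum_torus_mult: "f \<in> quantum_torus \<Longrightarrow> g \<in> quantum_torus \<Longrightarrow> f * g \<in> quantum_torus"
proof -
  assume "f \<in> quantum_torus" "g \<in> quantum_torus"
  then have fin: "finite {b. coeff f b \<noteq> 0}" "finite {b. coeff g b \<noteq> 0}"
    by (simp_all add: quantum_torus_def)
  have "{n. coeff (f * g) n \<noteq> 0} \<subseteq> (\<lambda>(i, j). i + j) ` ({b. coeff f b \<noteq> 0} \<times> {b. coeff g b \<noteq> 0})"
  proof
    fix n assume "n \<in> {n. coeff (f * g) n \<noteq> 0}"
    then obtain i where "coeff f i * twist i (coeff g (n - i)) \<noteq> 0"
      unfolding times_qseries.rep_eq by (auto elim: Sum_any.not_neutral_obtains_not_neutral)
    then have "coeff f i \<noteq> 0" "coeff g (n - i) \<noteq> 0" by auto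
    then show "n \<in> (\<lambda>(i, j). i + j) ` ({b. coeff f b \<noteq> 0} \<times> {b. coeff g b \<noteq> 0})"
      by (intro image_eqI [of _ _ "(i, n - i)"]) auto
  qed
  then show ?thesis unfolding quantum_torus_def using fin by (auto intro: finite_subset)
qed

lemma quantum_torus_add: "f \<in> quantum_torus \<Longrightarrow> g \<in> quantum_torus \<Longrightarrow> f + g \<in> quantum_torus"
  unfolding quantum_torus_def mem_Collect_eq
  by (rule finite_subset [of _ "{b. coeff f b \<noteq> 0} \<union> {b. coeff g b \<noteq> 0}"]) auto

lemma quantum_torus_diff: "f \<in> quantum_torus \<Longrightarrow> g \<in> quantum_torus \<Longrightarrow> f - g \<in> quantum_torus"
  unfolding quantum_torus_def mem_Collect_eq
  by (rule finite_subset [of _ "{b. coeff f b \<noteq> 0} \<union> {b. coeff g b \<noteq> 0}"]) auto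

lemma quantum_torus_qmono: "qmono c a b \<in> quantum_torus"
  unfolding quantum_torus_def mem_Collect_eq
  by (rule finite_subset [of _ "{b}"]) (auto simp: coeff_qmono)

lemma Qhat_in_quantum_torus: "Qhat j \<in> quantum_torus"
proof -
  have C: "conserved \<in> quantum_torus"
    unfolding conserved_monomials
    by (intro quantum_torus_add quantum_torus_diff quantum_torus_qmono)
  have "Qhat j \<in> quantum_torus \<and> Qhat (j + 1) \<in> quantum_torus"
  proof (induction j rule: int_induct [where k = 0])
    case base
    then show ?case by (simp add: q0_def q1_def quantum_torus_qmono)
  next
    case (step1 i)
    have "Qhat (i + 1 + 1) = conserved * Qhat (i + 1) - tq * Qhat i"
      using Qhat_linear [of "i + 1"] by simp
    with step1 C show ?case
      by (simp only:) (simp add: scalar_def quantum_torus_diff quantum_torus_mult quantum_torus_qmono)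
  next
    case (step2 i)
    have "Qhat (i - 1) = tq_inv * (conserved * Qhat i - Qhat (i + 1))"
      by (simp add: Qhat_linear)
    with step2 C show ?case
      by (simp add: scalar_def quantum_torus_diff quantum_torus_mult quantum_torus_qmono)
  qed
  then show ?thesis ..
qed

inductive_set A_plus :: "qseries set" where
  scalar: "scalar c \<in> A_plus"
| q0: "q0 \<in> A_plus"
| q0_inv: "q0_inv \<in> A_plus"
| Qhat: "m \<ge> 1 \<Longrightarrow> Qhat m \<in> A_plus"
| add: "p \<in> A_plus \<Longrightarrow> q \<in> A_plus \<Longrightarrow> p + q \<in> A_plus"
| mult: "p \<in> A_plus \<Longrightarrow> q \<in> A_plus \<Longrightarrow> p * q \<in> A_plus"

lemma A_plus_subset_quantum_torus: "A_plus \<subseteq> quantum_torus"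
proof
  fix p assume "p \<in> A_plus"
  then show "p \<in> quantum_torus"
    by induction
      (simp_all add: scalar_def q0_def q0_inv_def quantum_torus_qmono Qhat_in_quantum_torus
        quantum_torus_add quantum_torus_mult)
qed

section \<open>The constant term functionals\<close>

definition ring_inv :: "'a::ring_1 \<Rightarrow> 'a"
  where "ring_inv x = (THE y. x * y = 1 \<and> y * x = 1)"

lemma ring_inv_eq:
  assumes "x * y = 1" "y * x = 1"
  shows "ring_inv x = y"
  unfolding ring_inv_def
proof (rule the_equality)
  fix z assume "x * z = 1 \<and> z * x = 1"
  then show "z = y" using assms by (metis mult.assoc mult.right_neutral mult.left_neutral)
qed (use assms in auto)

text \<open>Convergence of a sequence for the filtration of the series ring by the degree in \<open>Q\<^sub>1\<close>.\<close>

definition qlim :: "(nat \<Rightarrow> qseries) \<Rightarrow> qseries \<Rightarrow> bool"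
  where "qlim X f \<longleftrightarrow> (\<forall>N. \<exists>K. \<forall>k\<ge>K. deg_le (X k - f) N)"

definition zlim :: qseries
  where "zlim = (THE f. qlim (\<lambda>k. Qhat (int k) * ring_inv (Qhat (int k + 1))) f)"

lemma qlim_unique:
  assumes "qlim X f" "qlim X g"
  shows "f = g"
proof (rule qseries_eqI)
  fix b
  obtain K where K: "\<forall>k\<ge>K. deg_le (X k - f) (b - 1)" using assms(1) by (auto simp: qlim_def)
  obtain L where L: "\<forall>k\<ge>L. deg_le (X k - g) (b - 1)" using assms(2) by (auto simp: qlim_def)
  have "coeff (X (max K L) - f) b = 0" "coeff (X (max K L) - g) b = 0"
    using K L by (auto simp: deg_le_def simp del: coeff_diff)
  then show "coeff f b = coeff g b" by simp
qed

lemma qlim_mult: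
  assumes "qlim X f"
  shows "qlim (\<lambda>k. g * X k) (g * f)" "qlim (\<lambda>k. X k * g) (f * g)"
proof -
  obtain M where M: "deg_le g M" using deg_le_exists [of g] by blast
  have ex: "\<exists>K. \<forall>k\<ge>K. deg_le (X k - f) (N - M)" for N
    using assms by (auto simp: qlim_def)
  have "deg_le (g * X k - g * f) N" "deg_le (X k * g - f * g) N" if "deg_le (X k - f) (N - M)" for k N
    using deg_le_mult [OF M that] deg_le_mult [OF that M] by (simp_all add: algebra_simps)
  then show "qlim (\<lambda>k. g * X k) (g * f)" "qlim (\<lambda>k. X k * g) (f * g)"
    unfolding qlim_def using ex by meson+
qed

lemma qlim_Suc_eventually:
  assumes "\<And>k. deg_le (X (Suc k) - X k) (- int k)"
  obtains f where "qlim X f"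
proof -
  have cauchy: "deg_le (X l - X k) (- int k)" if "k \<le> l" for k l
    using that
  proof (induction l rule: dec_induct)
    case base
    then show ?case by (simp add: deg_le_def)
  next
    case (step l)
    have "deg_le (X (Suc l) - X l) (- int k)"
      using assms [of l] step by (auto intro: deg_le_mono)
    from deg_le_add [OF this step(3)] show ?case by simp
  qed
  have stable: "coeff (X l) b = coeff (X k) b" if "k \<le> l" "b > - int k" for k l b
    using cauchy [OF that(1)] that(2) by (simp add: deg_le_def)
  define c where "c b = coeff (X (nat (1 - b))) b" for b
  have c: "c b = coeff (X k) b" if "b > - int k" for b k
    unfolding c_def using that by (intro stable [symmetric]) arith+
  obtain M where M: "deg_le (X 0) M" using deg_le_exists [of "X 0"] by blast
  have "c b = 0" if "b > max M 0" for b
    using that M by (simp add: c [of 0 b] deg_le_def)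
  then have "coeff (Abs_qseries c) = c"
    by (intro Abs_qseries_inverse) blast
  then have deg: "deg_le (X k - Abs_qseries c) (- int k)" for k
    by (auto simp: deg_le_def c)
  have "deg_le (X k - Abs_qseries c) N" if "k \<ge> nat (- N)" for k N
    by (rule deg_le_mono [OF deg]) (use that in arith)
  then have "qlim X (Abs_qseries c)" unfolding qlim_def by blast
  then show thesis by (rule that)
qed

lemma deg_le_qlim:
  assumes "qlim X f" "\<And>k. deg_le (X k) N"
  shows "deg_le f N"
  unfolding deg_le_def
proof (intro allI impI)
  fix b assume "b > N"
  obtain K where "deg_le (X K - f) N" using assms(1) by (auto simp: qlim_def)
  then show "coeff f b = 0" using assms(2) [of K] \<open>b > N\<close> by (simp add: deg_le_def)
qed

lemma geometric_inverse:
  assumes "deg_le h (- 1)"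
  obtains s where "deg_le s 0" "(1 - h) * s = 1" "s * (1 - h) = 1"
proof -
  define S where "S n = (\<Sum>i<n. h ^ i)" for n
  have pow: "deg_le (h ^ n) (- int n)" for n
  proof (induction n)
    case 0
    then show ?case by (simp add: deg_le_def coeff_1)
  next
    case (Suc n)
    from deg_le_mult [OF assms Suc] show ?case by simp
  qed
  have "deg_le (S (Suc k) - S k) (- int k)" for k
    by (simp add: S_def pow)
  then obtain s where s: "qlim S s" by (rule qlim_Suc_eventually)
  have S_0: "S 0 = 0" and S_Suc: "S (Suc n) = S n + h ^ n" for n
    by (simp_all add: S_def)
  have S1: "(1 - h) * S n = 1 - h ^ n" for n
    by (induction n) (simp_all add: S_0 S_Suc distrib_left, simp add: left_diff_distrib)
  have S2: "S n * (1 - h) = 1 - h ^ n" for n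
    by (induction n) (simp_all add: S_0 S_Suc distrib_right, simp add: right_diff_distrib power_commutes)
  have lim1: "qlim (\<lambda>n. 1 - h ^ n) 1"
    unfolding qlim_def
  proof
    fix N
    have "deg_le (1 - h ^ k - 1) N" if "k \<ge> nat (- N)" for k
    proof -
      have "deg_le (h ^ k) N" using pow [of k] that by (auto intro: deg_le_mono)
      then show ?thesis by (simp add: deg_le_def)
    qed
    then show "\<exists>K. \<forall>k\<ge>K. deg_le (1 - h ^ k - 1) N" by blast
  qed
  have "deg_le (S n) 0" for n
  proof (induction n)
    case 0
    then show ?case by (simp add: S_def deg_le_def)
  next
    case (Suc n)
    have "deg_le (h ^ n) 0" using pow [of n] by (auto intro: deg_le_mono)
    with Suc show ?case by (simp add: S_def deg_le_add)
  qed
  with s have "deg_le s 0" by (rule deg_le_qlim)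
  moreover have "(1 - h) * s = 1"
    using qlim_unique [OF qlim_mult(1) [OF s, of "1 - h"]] lim1 by (simp add: S1)
  moreover have "s * (1 - h) = 1"
    using qlim_unique [OF qlim_mult(2) [OF s, of "1 - h"]] lim1 by (simp add: S2)
  ultimately show thesis by (rule that)
qed

lemma monomial_leading_inverse:
  assumes "deg_le f N" "coeff f N = Poly_Mapping.single a (tpow e)"
  obtains g where "f * g = 1" "g * f = 1" "deg_le g (- N)"
proof -
  define m where "m = qmono (tpow e) a N"
  define m' where "m' = qmono (tpow (- N * a - e)) (- a) (- N)"
  have m: "m * m' = 1"
    by (simp add: m_def m'_def qmono_mult flip: tpow_add)
  define h where "h = (m - f) * m'"
  have "deg_le (m - f) (N - 1)"
    unfolding deg_le_def
  proof (intro allI impI)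
    fix b assume "b > N - 1"
    then have "b = N \<or> b > N" by auto
    then show "coeff (m - f) b = 0"
      using assms by (auto simp: m_def coeff_qmono deg_le_def)
  qed
  from deg_le_mult [OF this deg_le_qmono [of "tpow (- N * a - e)" "- a" "- N"]]
  have "deg_le h (- 1)" by (simp add: h_def m'_def)
  then obtain s where s: "deg_le s 0" "(1 - h) * s = 1" "s * (1 - h) = 1"
    by (rule geometric_inverse)
  have "1 - h = f * m'" by (simp add: h_def left_diff_distrib m)
  with s have fg: "f * (m' * s) = 1" by (simp add: mult.assoc)
  then have "f * (m' * s) * f = f" by (simp only: mult_1_left)
  then have "f * (m' * s * f - 1) = 0"
    by (simp add: right_diff_distrib mult.assoc)
  moreover have "f \<noteq> 0" using fg by auto
  ultimately have gf: "m' * s * f = 1" by simp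
  have "deg_le (m' * s) (- N)"
    using deg_le_mult [OF deg_le_qmono s(1)] by (simp add: m'_def)
  with fg gf show thesis by (rule that)
qed

lemma Qhat_leading:
  "deg_le (Qhat (int n)) (int n) \<and>
    (\<exists>e. coeff (Qhat (int n)) (int n) = Poly_Mapping.single (1 - int n) (tpow e))"
proof (induction n rule: induct_nat_012)
  case 0
  show ?case by (auto simp: q0_def deg_le_qmono coeff_qmono intro: exI [of _ 0])
next
  case 1
  show ?case by (auto simp: q1_def deg_le_qmono coeff_qmono intro: exI [of _ 0])
next
  case (ge2 n)
  let ?n = "int n"
  have rec: "Qhat (?n + 2) = conserved * Qhat (?n + 1) - tq * Qhat ?n"
    using Qhat_linear [of "?n + 1"] by (simp add: add.assoc)
  obtain e where e: "deg_le (Qhat (?n + 1)) (?n + 1)"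
    "coeff (Qhat (?n + 1)) (?n + 1) = Poly_Mapping.single (- ?n) (tpow e)"
    using ge2(2) by (auto simp: add.commute)
  have C: "deg_le conserved 1"
    unfolding conserved_monomials
    by (intro deg_le_add deg_le_diff deg_le_mono [OF deg_le_qmono]) auto
  have C1: "coeff conserved 1 = Poly_Mapping.single (- 1) (tpow 1)"
    by (simp add: conserved_monomials coeff_qmono)
  have tQ: "deg_le (tq * Qhat ?n) ?n"
    using deg_le_mult [OF deg_le_qmono, of "Qhat ?n" ?n "tpow 1" 0 0] ge2(1) by (simp add: scalar_def)
  have "deg_le (Qhat (?n + 2)) (?n + 2)"
    unfolding rec using deg_le_mult [OF C e(1)] tQ
    by (auto intro!: deg_le_diff elim: deg_le_mono simp: algebra_simps)
  moreover have "coeff (Qhat (?n + 2)) (?n + 2) = Poly_Mapping.single (- 1 - ?n) (tpow (1 + ?n + e))"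
  proof -
    have "coeff (tq * Qhat ?n) (?n + 2) = 0" using tQ by (simp add: deg_le_def)
    moreover have "coeff (conserved * Qhat (?n + 1)) (1 + (?n + 1))
        = Poly_Mapping.single (- 1 - ?n) (tpow (1 + ?n + e))"
      unfolding coeff_mult_top [OF C e(1)] e(2) C1
      by (simp add: twist_single mult_single add.assoc flip: tpow_add)
    moreover have "1 + (?n + 1) = ?n + 2" by simp
    ultimately show ?thesis unfolding rec by (simp only: coeff_diff) simp
  qed
  ultimately show ?case by (auto simp: algebra_simps)
qed

lemma Qhat_inverse:
  "Qhat (int n) * ring_inv (Qhat (int n)) = 1" "ring_inv (Qhat (int n)) * Qhat (int n) = 1"
  "deg_le (ring_inv (Qhat (int n))) (- int n)"
proof -
  obtain g where "Qhat (int n) * g = 1" "g * Qhat (int n) = 1" "deg_le g (- int n)"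
    using Qhat_leading [of n] monomial_leading_inverse by blast
  moreover from this have "ring_inv (Qhat (int n)) = g" by (intro ring_inv_eq)
  ultimately show "Qhat (int n) * ring_inv (Qhat (int n)) = 1"
    "ring_inv (Qhat (int n)) * Qhat (int n) = 1" "deg_le (ring_inv (Qhat (int n))) (- int n)"
    by simp_all
qed

text \<open>The telescoping identity behind the product formula
  \<open>z = Q\<^sub>0 Q\<^sub>1\<^sup>-\<^sup>1 (1 - Q\<^sub>1\<^sup>-\<^sup>2)\<^sup>-\<^sup>1 (1 - Q\<^sub>2\<^sup>-\<^sup>2)\<^sup>-\<^sup>1 \<dots>\<close>\<close>

lemma Qhat_ratio:
  "Qhat (int (Suc k)) * ring_inv (Qhat (int (Suc k) + 1)) * (1 - (ring_inv (Qhat (int (Suc k))))\<^sup>2)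
    = Qhat (int k) * ring_inv (Qhat (int k + 1))"
proof -
  define a where "a = Qhat (int k)"
  define b where "b = Qhat (int (Suc k))"
  define c where "c = Qhat (int (Suc (Suc k)))"
  have idx: "int k + 1 = int (Suc k)" "int (Suc k) + 1 = int (Suc (Suc k))" by simp_all
  have inv: "b * ring_inv b = 1" "ring_inv b * b = 1" "c * ring_inv c = 1" "ring_inv c * c = 1"
    unfolding b_def c_def by (rule Qhat_inverse)+
  have cancel: "b * (ring_inv b * x) = x" "ring_inv c * (c * x) = x" for x
    using inv by (simp_all add: mult.assoc [symmetric])
  have bc: "tq * c * a = b\<^sup>2 - 1"
    using Qhat_rec [of "int (Suc k)"] by (simp add: a_def b_def c_def add.commute)
  have ab: "a * b = tq * b * a"
    using Qhat_commute [of "int k"] by (simp add: a_def b_def add.commute)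
  have sq: "1 - (ring_inv b)\<^sup>2 = (b\<^sup>2 - 1) * (ring_inv b * ring_inv b)"
    using cancel(1) inv(1) by (simp add: left_diff_distrib power2_eq_square mult.assoc)
  have "b * ring_inv c * (1 - (ring_inv b)\<^sup>2) = b * ring_inv c * (tq * c * a) * (ring_inv b * ring_inv b)"
    unfolding sq bc by (simp add: mult.assoc)
  also have "\<dots> = (tq * b * a) * (ring_inv b * ring_inv b)"
    using scalar_central [of "tpow 1" c] scalar_central [of "tpow 1" b]
    by (metis cancel(2) mult.assoc)
  also have "\<dots> = a * ring_inv b"
    unfolding ab [symmetric] by (simp add: mult.assoc cancel(1))
  finally show ?thesis unfolding idx a_def b_def c_def .
qed

lemma zlim_exists: "\<exists>!f. qlim (\<lambda>k. Qhat (int k) * ring_inv (Qhat (int k + 1))) f"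
proof -
  define X where "X k = Qhat (int k) * ring_inv (Qhat (int k + 1))" for k
  have idx: "int k + 1 = int (Suc k)" for k by simp
  have degX: "deg_le (X k) (- 1)" for k
    unfolding X_def idx using deg_le_mult [OF _ Qhat_inverse(3) [of "Suc k"]] Qhat_leading [of k]
    by fastforce
  have "deg_le (X (Suc k) - X k) (- int k)" for k
  proof -
    define b where "b = ring_inv (Qhat (int (Suc k)))"
    have "X (Suc k) - X k = X (Suc k) * (b * b)"
      using Qhat_ratio [of k] unfolding X_def [symmetric] b_def [symmetric]
      by (simp add: right_diff_distrib power2_eq_square algebra_simps)
    moreover have "deg_le b (- int (Suc k))" unfolding b_def by (rule Qhat_inverse)
    ultimately have "deg_le (X (Suc k) - X k) (- 1 + (- int (Suc k) + - int (Suc k)))"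
      by (simp only: deg_le_mult degX)
    then show ?thesis by (rule deg_le_mono) simp
  qed
  then obtain f where "qlim X f" by (rule qlim_Suc_eventually)
  then show ?thesis using qlim_unique unfolding X_def by blast
qed

text \<open>Setting \<open>Q\<^sub>0 = 1\<close> after normal ordering sums the (finitely many) coefficients of
  \<open>Q\<^sub>0 ^ a Q\<^sub>1 ^ 0\<close>.\<close>

definition CT_q1_at_q0_1 :: "qseries \<Rightarrow> laurent_t"
  where "CT_q1_at_q0_1 f = (\<Sum>a. Poly_Mapping.lookup (coeff f 0) a)"

definition mu :: "nat \<Rightarrow> qseries \<Rightarrow> laurent_t"
  where "mu l p = CT_q1_at_q0_1 (q1 * q0_inv * p * zlim ^ (l + 1))"

section \<open>The cyclic right representation\<close>

text \<open>\<open>bra m\<close> is \<open>\<langle>m|\<close> and \<open>ket l v\<close> is the pairing \<open>\<langle>v|l\<rangle>\<close>. The action is written on the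
  right, \<open>act v p = v p\<close>, and is only constrained for \<open>p\<close> in the algebra.\<close>

locale cyclic_rep = module scale
  for scale :: "laurent_t \<Rightarrow> 'v::ab_group_add \<Rightarrow> 'v" +
  fixes act :: "'v \<Rightarrow> qseries \<Rightarrow> 'v"
    and bra :: "nat \<Rightarrow> 'v"
    and ket :: "nat \<Rightarrow> 'v \<Rightarrow> laurent_t"
  assumes act_add_left: "p \<in> A_plus \<Longrightarrow> act (v + w) p = act v p + act w p"
    and act_scale_left: "p \<in> A_plus \<Longrightarrow> act (scale c v) p = scale c (act v p)"
    and act_add_right: "p \<in> A_plus \<Longrightarrow> q \<in> A_plus \<Longrightarrow> act v (p + q) = act v p + act v q"
    and act_mult: "p \<in> A_plus \<Longrightarrow> q \<in> A_plus \<Longrightarrow> act v (p * q) = act (act v p) q"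
    and act_scalar: "act v (scalar c) = scale c v"
    and cyclic: "\<exists>p\<in>A_plus. v = act (bra 0) p"
    and bra_inj: "inj bra"
    and bra_independent: "independent (range bra)"
    and bra_span: "span (range bra) = UNIV"
    and bra_0_q0: "act (bra 0) q0 = scale (tpow (- 1)) (bra 0)"
    and bra_Qhat: "m > 0 \<Longrightarrow> bra m = scale (tpow (int m + 1)) (act (bra 0) (Qhat (int m)))"
    and ket_hom: "module_hom scale (*) (ket l)"
    and ket_bra: "ket l (bra m) = (if m = l then 1 else 0)"

end

theory Submission
  imports Defs
begin

text \<open>Put \<open>I = (Q\<^sub>0 - t\<^sup>-\<^sup>1) \<A>\<^sub>+ + Q\<^sub>-\<^sub>1 \<A>\<^sub>+\<close>. Since \<open>\<A>\<^sub>+\<close> is generated by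
  \<open>Q\<^sub>0\<^sup>\<plusminus>\<^sup>1, Q\<^sub>1, Q\<^sub>-\<^sub>1\<close> and both products of \<open>Q\<^sub>1\<close> and \<open>Q\<^sub>-\<^sub>1\<close> are polynomials in \<open>Q\<^sub>0\<close>,
  the powers of \<open>Q\<^sub>1\<close>, and by triangularity also the \<open>Q\<^sub>m\<close> with \<open>m \<ge> 0\<close>, span \<open>\<A>\<^sub>+\<close> modulo \<open>I\<close>.
  Hence it suffices that both sides vanish on \<open>I\<close> and agree on the \<open>Q\<^sub>m\<close>. For \<open>\<mu>\<^sub>l\<close> this follows
  from the quadratic equation \<open>C z = 1 + t z\<^sup>2\<close>, \<open>C\<close> being the conserved quantity with
  \<open>Q\<^sub>j C = t Q\<^sub>j\<^sub>+\<^sub>1 + Q\<^sub>j\<^sub>-\<^sub>1\<close>. For the representation the only issue is \<open>\<langle>0|Q\<^sub>-\<^sub>1 = 0\<close>, which follows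
  by comparing \<open>Q\<^sub>0\<close>-weights.\<close>

section \<open>Relations in the algebra\<close>

lemmas torus_monomials = q0_def q0_inv_def q1_def q1_inv_def scalar_def

lemma scalar_mult: "scalar (c * d) = scalar c * scalar d"
  by (simp add: scalar_def qmono_mult)

lemma scalar_uminus: "scalar (- c) = - scalar c"
  by (simp add: scalar_def qmono_uminus)

lemma scalar_1 [simp]: "scalar 1 = 1"
  by (simp add: scalar_def)

lemma scalar_left_commute: "f * (scalar c * g) = scalar c * (f * g)"
  by (metis mult.assoc scalar_central)

lemma Qhat_neg1: "Qhat (- 1) = qmono (tpow 1) 2 (- 1) - qmono (tpow (- 1)) 0 (- 1)"
proof -
  have "Qhat (- 1) = tq_inv * (conserved * q0 - q1)"
    using Qhat_linear [of 0] by simp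
  also have "\<dots> = qmono (tpow 1) 2 (- 1) - qmono (tpow (- 1)) 0 (- 1)"
    by (simp add: conserved_monomials torus_monomials algebra_simps qmono_mult flip: tpow_add)
  finally show ?thesis .
qed

lemma q1_q0: "q1 * q0 = tq_inv * q0 * q1"
  and q1_q0_inv: "q1 * q0_inv = tq * q0_inv * q1"
  and Qhat_neg1_q0: "Qhat (- 1) * q0 = tq * q0 * Qhat (- 1)"
  and q1_Qhat_neg1: "q1 * Qhat (- 1) = tq_inv * (q0 * q0 - 1)"
  and Qhat_neg1_q1: "Qhat (- 1) * q1 = tq * (q0 * q0) - tq_inv"
  and conserved_eq: "conserved = q0_inv * (tq * q1 + Qhat (- 1))"
  by (simp_all add: Qhat_neg1 conserved_monomials torus_monomials algebra_simps qmono_mult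
      flip: tpow_add)

text \<open>Left and right multiplication by \<open>conserved\<close> commute with each other, so
  the defect \<open>e\<close> again solves the left recursion. It vanishes at 0 and 1, hence
  everywhere.\<close>

lemma Qhat_linear_right: "Qhat j * conserved = tq * Qhat (j + 1) + Qhat (j - 1)"
proof -
  define e where "e j = Qhat j * conserved - tq * Qhat (j + 1) - Qhat (j - 1)" for j
  have "conserved * e j = e (j + 1) + tq * e (j - 1)" for j
  proof -
    have "conserved * e j = (conserved * Qhat j) * conserved - tq * (conserved * Qhat (j + 1))
        - conserved * Qhat (j - 1)"
      by (simp add: e_def right_diff_distrib scalar_left_commute mult.assoc)
    also have "\<dots> = e (j + 1) + tq * e (j - 1)"
      unfolding Qhat_linear by (simp add: e_def algebra_simps)
    finally show ?thesis .
  qed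
  moreover have "e 0 = 0"
    unfolding e_def
    by (simp add: Qhat_neg1 conserved_monomials torus_monomials algebra_simps qmono_mult
        flip: tpow_add)
  moreover have "e 1 = 0"
  proof -
    have "Qhat 2 = conserved * q1 - tq * q0" using Qhat_linear [of 1] by simp
    then show ?thesis
      unfolding e_def
      by simp (simp add: conserved_monomials torus_monomials algebra_simps qmono_mult flip: tpow_add)
  qed
  ultimately have "e j = 0" by (rule linear_recursion_0)
  then show ?thesis by (simp add: e_def algebra_simps)
qed

section \<open>Membership in \<open>A_plus\<close>\<close>

lemma one_in_A_plus: "1 \<in> A_plus"
  using A_plus.scalar [of 1] by simp

lemma A_plus_diff: "p \<in> A_plus \<Longrightarrow> q \<in> A_plus \<Longrightarrow> p - q \<in> A_plus"
  using A_plus.add [of p "scalar (- 1) * q"] A_plus.mult [OF A_plus.scalar, of q "- 1"]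
  by (simp add: scalar_uminus)

lemma A_plus_power: "p \<in> A_plus \<Longrightarrow> p ^ n \<in> A_plus"
  by (induction n) (auto intro: one_in_A_plus A_plus.mult)

lemma q1_in_A_plus: "q1 \<in> A_plus"
  using A_plus.Qhat [of 1] by simp

lemma Qhat_nat_in_A_plus: "Qhat (int m) \<in> A_plus"
  by (cases "m = 0") (auto intro: A_plus.q0 A_plus.Qhat)

text \<open>Neither \<open>conserved\<close> nor \<open>Q\<^sub>-\<^sub>1\<close> is visibly in \<open>\<A>\<^sub>+\<close>; the former is a quadratic expression
  in the generators.\<close>

lemma conserved_in_A_plus: "conserved \<in> A_plus"
proof -
  have Q2: "Qhat 2 = conserved * q1 - tq * q0"
    using Qhat_linear [of 1] by simp
  have Q3: "Qhat 3 = conserved * Qhat 2 - tq * q1"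
    using Qhat_linear [of 2] by simp
  \<comment> \<open>At t = 1 the recursion and the Q-system give Q_1 Q_2 - Q_0 Q_3 = C (Q_1^2 - Q_0
    Q_2) = C, with C for \<open>conserved\<close>; the powers of t correct for the ordering.\<close>
  have "conserved = scalar (tpow 2) * (tq * (q1 * Qhat 2) - q0 * Qhat 3)"
    unfolding Q3 Q2
    by (simp add: conserved_monomials torus_monomials algebra_simps qmono_mult flip: tpow_add)
  moreover have "scalar (tpow 2) * (tq * (q1 * Qhat 2) - q0 * Qhat 3) \<in> A_plus"
    by (intro A_plus.mult A_plus_diff A_plus.scalar q1_in_A_plus A_plus.q0 A_plus.Qhat) auto
  ultimately show ?thesis by simp
qed

lemma Qhat_neg1_in_A_plus: "Qhat (- 1) \<in> A_plus"
proof -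
  have "Qhat (- 1) = q0 * conserved - tq * q1"
    using Qhat_linear_right [of 0] by simp
  then show ?thesis
    by (auto intro: A_plus_diff A_plus.mult A_plus.q0 A_plus.scalar q1_in_A_plus conserved_in_A_plus)
qed

lemmas A_plus_closed = A_plus.intros one_in_A_plus A_plus_diff A_plus_power q1_in_A_plus
  Qhat_nat_in_A_plus conserved_in_A_plus Qhat_neg1_in_A_plus


section \<open>Functionals vanishing on the right ideal of the vacuum\<close>

text \<open>The sum of the right ideal \<open>I\<close> and the span of the powers of
  \<open>q1\<close> below \<open>n\<close>. Keeping track of \<open>n\<close> is what lets
  triangularity of the \<open>Qhat m\<close> be expressed.\<close>

inductive_set vacuum_span :: "nat \<Rightarrow> qseries set" for n where
  power: "k < n \<Longrightarrow> q1 ^ k \<in> vacuum_span n"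
| weight: "x \<in> A_plus \<Longrightarrow> q0 * x - tq_inv * x \<in> vacuum_span n"
| lower: "x \<in> A_plus \<Longrightarrow> Qhat (- 1) * x \<in> vacuum_span n"
| scale: "x \<in> vacuum_span n \<Longrightarrow> scalar c * x \<in> vacuum_span n"
| add: "x \<in> vacuum_span n \<Longrightarrow> y \<in> vacuum_span n \<Longrightarrow> x + y \<in> vacuum_span n"

lemma vacuum_span_in_A_plus: "x \<in> vacuum_span n \<Longrightarrow> x \<in> A_plus"
  by (induction rule: vacuum_span.induct) (auto intro: A_plus_closed)

lemma vacuum_span_mono: "x \<in> vacuum_span m \<Longrightarrow> m \<le> n \<Longrightarrow> x \<in> vacuum_span n"
  by (induction rule: vacuum_span.induct) (auto intro: vacuum_span.intros)

lemma vacuum_span_diff: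
  "x \<in> vacuum_span n \<Longrightarrow> y \<in> vacuum_span n \<Longrightarrow> x - y \<in> vacuum_span n"
  using vacuum_span.add [of x n "scalar (- 1) * y"] vacuum_span.scale [of y n "- 1"]
  by (simp add: scalar_uminus)

text \<open>\<open>I\<close> is only a right ideal, but modulo \<open>I\<close> left multiplication
  by \<open>q0\<close> is the scalar t^-1.\<close>

lemma vacuum_span_q0_left: "x \<in> vacuum_span n \<Longrightarrow> q0 * x \<in> vacuum_span n"
  using vacuum_span.add [OF vacuum_span.weight vacuum_span.scale, of x x n "tpow (- 1)"]
    vacuum_span_in_A_plus by simp

lemma vacuum_span_q0_inv:
  assumes "x \<in> A_plus"
  shows "q0_inv * x - tq * x \<in> vacuum_span n"
proof -
  have "scalar (- tpow 1) * (q0 * (q0_inv * x) - tq_inv * (q0_inv * x)) \<in> vacuum_span n"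
    using assms by (intro vacuum_span.scale vacuum_span.weight A_plus_closed)
  moreover have "q0 * (q0_inv * x) = x"
    by (simp add: q0_inverse flip: mult.assoc)
  ultimately show ?thesis by (simp add: scalar_uminus right_diff_distrib)
qed

lemma vacuum_span_q0_inv_left:
  assumes "x \<in> vacuum_span n"
  shows "q0_inv * x \<in> vacuum_span n"
  using vacuum_span.add [OF vacuum_span_q0_inv vacuum_span.scale [OF assms, of "tpow 1"], of x]
    vacuum_span_in_A_plus [OF assms] by simp

section \<open>Right multiplication and the degree filtration\<close>

definition raises :: "nat \<Rightarrow> qseries \<Rightarrow> bool"
  where "raises d y \<longleftrightarrow> (\<forall>n. \<forall>x\<in>vacuum_span n. x * y \<in> vacuum_span (n + d))"

text \<open>The generators of \<open>I\<close> absorb a right factor from \<open>A_plus\<close>, so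
  only the powers of \<open>q1\<close> have to be tested.\<close>

lemma raisesI:
  assumes "y \<in> A_plus" "\<And>k n. k < n \<Longrightarrow> q1 ^ k * y \<in> vacuum_span (n + d)"
  shows "raises d y"
  unfolding raises_def
proof (intro allI ballI)
  fix n x assume "x \<in> vacuum_span n"
  then show "x * y \<in> vacuum_span (n + d)"
  proof (induction rule: vacuum_span.induct)
    case (weight x)
    then show ?case
      using vacuum_span.weight [of "x * y"] assms(1)
      by (simp add: left_diff_distrib mult.assoc A_plus_closed)
  next
    case (lower x)
    then show ?case
      using vacuum_span.lower [of "x * y"] assms(1) by (simp add: mult.assoc A_plus_closed)
  qed (auto simp: assms(2) distrib_right mult.assoc intro: vacuum_span.intros)
qed

lemma raises_mono: "raises d y \<Longrightarrow> d \<le> e \<Longrightarrow> raises e y"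
  unfolding raises_def by (meson vacuum_span_mono add_left_mono)

lemma raises_add: "raises d y \<Longrightarrow> raises d z \<Longrightarrow> raises d (y + z)"
  and raises_diff: "raises d y \<Longrightarrow> raises d z \<Longrightarrow> raises d (y - z)"
  by (auto simp: raises_def distrib_left right_diff_distrib intro: vacuum_span.add vacuum_span_diff)

lemma raises_mult: "raises d y \<Longrightarrow> raises e z \<Longrightarrow> raises (d + e) (y * z)"
  unfolding raises_def mult.assoc [symmetric] add.assoc [symmetric] by blast

lemma raises_scalar: "raises 0 (scalar c)"
  by (auto simp: raises_def scalar_central [symmetric] intro: vacuum_span.scale)

lemma q1_power_q0: "q1 ^ k * q0 = scalar (tpow (- int k)) * (q0 * q1 ^ k)"
proof (induction k)
  case (Suc k)
  have "q1 ^ Suc k * q0 = q1 * (q1 ^ k * q0)" by (simp add: mult.assoc)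
  also have "\<dots> = scalar (tpow (- int k)) * ((q1 * q0) * q1 ^ k)"
    unfolding Suc by (simp add: scalar_left_commute mult.assoc)
  also have "\<dots> = scalar (tpow (- int k) * tpow (- 1)) * (q0 * q1 ^ Suc k)"
    unfolding q1_q0 by (simp add: scalar_mult mult.assoc)
  finally show ?case by (simp add: algebra_simps flip: tpow_add)
qed simp

lemma q1_power_q0_inv: "q1 ^ k * q0_inv = scalar (tpow (int k)) * (q0_inv * q1 ^ k)"
proof (induction k)
  case (Suc k)
  have "q1 ^ Suc k * q0_inv = q1 * (q1 ^ k * q0_inv)" by (simp add: mult.assoc)
  also have "\<dots> = scalar (tpow (int k)) * ((q1 * q0_inv) * q1 ^ k)"
    unfolding Suc by (simp add: scalar_left_commute mult.assoc)
  also have "\<dots> = scalar (tpow (int k) * tpow 1) * (q0_inv * q1 ^ Suc k)"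
    unfolding q1_q0_inv by (simp add: scalar_mult mult.assoc)
  finally show ?case by (simp add: add.commute flip: tpow_add)
qed simp

lemma raises_q0: "raises 0 q0" and raises_q0_inv: "raises 0 q0_inv"
  by (auto intro!: raisesI A_plus_closed vacuum_span.scale vacuum_span_q0_left vacuum_span_q0_inv_left
      vacuum_span.power simp: q1_power_q0 q1_power_q0_inv)

lemma raises_q1: "raises 1 q1"
proof (rule raisesI)
  fix k n :: nat assume "k < n"
  then show "q1 ^ k * q1 \<in> vacuum_span (n + 1)"
    using vacuum_span.power [of "Suc k" "n + 1"] by (simp add: power_commutes)
qed (rule q1_in_A_plus)

text \<open>The factor \<open>Qhat (- 1)\<close> either stands alone, hence lies in
  \<open>I\<close>, or meets a \<open>q1\<close>, and the two collapse to a polynomial in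
  \<open>q0\<close>, which does not raise the degree.\<close>

lemma raises_Qhat_neg1: "raises 0 (Qhat (- 1))"
proof (rule raisesI)
  fix k n :: nat assume "k < n"
  show "q1 ^ k * Qhat (- 1) \<in> vacuum_span (n + 0)"
  proof (cases k)
    case 0
    then show ?thesis using vacuum_span.lower [of 1 n] by (simp add: A_plus_closed)
  next
    case (Suc j)
    have "raises 0 (tq_inv * (q0 * q0 - 1))"
      using raises_mult [OF raises_scalar [of "tpow (- 1)"]
          raises_diff [OF raises_mult [OF raises_q0 raises_q0, simplified] raises_scalar [of 1]]]
      by simp
    moreover have "q1 ^ k * Qhat (- 1) = q1 ^ j * (tq_inv * (q0 * q0 - 1))"
      unfolding q1_Qhat_neg1 [symmetric] Suc power_Suc2 by (simp add: mult.assoc)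
    ultimately show ?thesis
      using vacuum_span.power [of j n] \<open>k < n\<close> Suc by (simp add: raises_def)
  qed
qed (rule Qhat_neg1_in_A_plus)

lemma raises_conserved: "raises 1 conserved"
proof -
  have "raises (0 + 1) (tq * q1 + Qhat (- 1))"
    by (intro raises_add raises_mult raises_scalar raises_q1 raises_mono [OF raises_Qhat_neg1]) simp
  from raises_mult [OF raises_q0_inv this] show ?thesis by (simp add: conserved_eq)
qed

lemma raises_Qhat: "raises m (Qhat (int m))"
proof (induction m rule: induct_nat_012)
  case (ge2 n)
  have "Qhat (int (Suc (Suc n))) = conserved * Qhat (int (Suc n)) - tq * Qhat (int n)"
    using Qhat_linear [of "int (Suc n)"] by (simp add: algebra_simps)
  moreover have "raises (Suc (Suc n)) (conserved * Qhat (int (Suc n)))"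
    using raises_mult [OF raises_conserved ge2(2)] by simp
  moreover have "raises (Suc (Suc n)) (tq * Qhat (int n))"
    using raises_mult [OF raises_scalar ge2(1), of "tpow 1"] by (rule raises_mono) simp
  ultimately show ?case by (simp only: raises_diff)
qed (use raises_q0 raises_q1 in simp_all)

lemma A_plus_raises: "p \<in> A_plus \<Longrightarrow> \<exists>d. raises d p"
proof (induction rule: A_plus.induct)
  case (Qhat m)
  then show ?case using raises_Qhat [of "nat m"] by auto
next
  case (add p q)
  then obtain d e where "raises d p" "raises e q" by blast
  then have "raises (max d e) (p + q)" by (intro raises_add) (auto intro: raises_mono)
  then show ?case ..
next
  case (mult p q)
  then show ?case using raises_mult by blast
qed (rule exI, rule raises_scalar raises_q0 raises_q0_inv)+

lemma A_plus_vacuum_span: "p \<in> A_plus \<Longrightarrow> \<exists>n. p \<in> vacuum_span n"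
proof -
  assume "p \<in> A_plus"
  then obtain d where "raises d p" using A_plus_raises by blast
  moreover have "1 \<in> vacuum_span 1" using vacuum_span.power [of 0 1] by simp
  ultimately have "1 * p \<in> vacuum_span (1 + d)" unfolding raises_def by blast
  then show ?thesis by auto
qed

text \<open>Triangularity between the \<open>Qhat m\<close> and the powers of \<open>q1\<close>, by
  the right recursion. The diagonal entries are powers of t.\<close>

lemma Qhat_leading_power:
  "\<exists>e. Qhat (int m) - scalar (tpow e) * q1 ^ m \<in> vacuum_span m"
proof (induction m rule: induct_nat_012)
  case 0
  have "q0 - tq_inv \<in> vacuum_span 0"
    using vacuum_span.weight [of 1 0] by (simp add: A_plus_closed)
  then show ?case by auto
next
  case 1
  have "0 \<in> vacuum_span 1"
    using vacuum_span_diff [OF vacuum_span.power [of 0 1] vacuum_span.power [of 0 1]] by simp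
  then show ?case by (auto intro: exI [of _ 0])
next
  case (ge2 n)
  let ?N = "Suc (Suc n)"
  obtain e where e: "Qhat (int (Suc n)) - scalar (tpow e) * q1 ^ Suc n \<in> vacuum_span (Suc n)"
    using ge2 by blast
  obtain e' where e': "Qhat (int n) - scalar (tpow e') * q1 ^ n \<in> vacuum_span n"
    using ge2 by blast
  define r where "r = Qhat (int (Suc n)) - scalar (tpow e) * q1 ^ Suc n"
  have Qn: "Qhat (int n) \<in> vacuum_span ?N"
  proof -
    have "scalar (tpow e') * q1 ^ n \<in> vacuum_span ?N"
      by (intro vacuum_span.scale vacuum_span.power) simp
    from vacuum_span.add [OF vacuum_span_mono [OF e'] this] show ?thesis by simp
  qed
  have rC: "r * conserved \<in> vacuum_span ?N"
    using raises_conserved e by (auto simp: raises_def r_def)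
  define X where "X = q1 ^ Suc n"
  define Y where "Y = q1 ^ ?N"
  have Y: "Y \<in> A_plus" unfolding Y_def by (intro A_plus_closed)
  have XY: "X * q1 = Y" unfolding X_def Y_def by (simp only: power_Suc2)
  define a where "a = tpow (int (Suc n))"
  \<comment> \<open>Modulo \<open>I\<close> the factor \<open>q0_inv\<close>, once moved to the
    left, is the scalar t. Only the summand with \<open>Y\<close> reaches the new top power.\<close>
  have XC: "X * conserved = scalar a * (q0_inv * (tq * Y)) + scalar a * (q0_inv * (X * Qhat (- 1)))"
  proof -
    have "X * conserved = (X * q0_inv) * (tq * q1 + Qhat (- 1))"
      by (simp only: conserved_eq mult.assoc)
    also have "X * q0_inv = scalar a * (q0_inv * X)"
      unfolding X_def a_def by (rule q1_power_q0_inv)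
    finally show ?thesis
      by (simp only: mult.assoc distrib_left scalar_left_commute [of X] XY)
  qed
  have low: "q0_inv * (X * Qhat (- 1)) \<in> vacuum_span ?N"
    using raises_Qhat_neg1 vacuum_span.power [of "Suc n" ?N]
    by (intro vacuum_span_q0_inv_left) (simp add: raises_def X_def del: power_Suc)
  have top: "q0_inv * (tq * Y) - tq * (tq * Y) \<in> vacuum_span ?N"
    using Y by (intro vacuum_span_q0_inv A_plus_closed)
  have "tq * Qhat (int ?N) = Qhat (int (Suc n)) * conserved - Qhat (int n)"
    using Qhat_linear_right [of "int (Suc n)"] by (simp add: algebra_simps)
  then have QN: "Qhat (int ?N) = tq_inv * (Qhat (int (Suc n)) * conserved - Qhat (int n))"
    by (metis tq_left(1))
  \<comment> \<open>The factors come from solving the recursion for its top term, the previous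
    leading coefficient, moving \<open>q0_inv\<close> past \<open>X\<close>, the t inside
    \<open>conserved\<close>, and \<open>q0_inv\<close> acting as t.\<close>
  define E where "E = tpow (- 1) * (tpow e * (a * (tpow 1 * tpow 1)))"
  have "Qhat (int (Suc n)) = r + scalar (tpow e) * X"
    by (simp add: r_def X_def)
  then have "Qhat (int ?N) - scalar E * Y = tq_inv * (r * conserved
     + scalar (tpow e) * (scalar a * (q0_inv * (tq * Y) - tq * (tq * Y))
     + scalar a * (q0_inv * (X * Qhat (- 1)))) - Qhat (int n))"
    unfolding QN E_def
    by (simp only: distrib_right mult.assoc XC)
      (simp add: scalar_mult distrib_left right_diff_distrib mult.assoc)
  also have "\<dots> \<in> vacuum_span ?N"
    by (intro vacuum_span.add vacuum_span.scale vacuum_span_diff rC top low Qn)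
  finally have "Qhat (int ?N) - scalar E * Y \<in> vacuum_span ?N" .
  moreover have "E = tpow (e + int n + 2)"
    by (simp add: E_def a_def add_ac flip: tpow_add)
  ultimately show ?case unfolding Y_def by blast
qed

text \<open>Linear functionals on \<open>A_plus\<close> that vanish on \<open>I\<close>. Differences
  of such functionals are of the same kind, so agreement reduces to vanishing.\<close>

locale vacuum_functional =
  fixes \<phi> :: "qseries \<Rightarrow> laurent_t"
  assumes \<phi>_add: "p \<in> A_plus \<Longrightarrow> q \<in> A_plus \<Longrightarrow> \<phi> (p + q) = \<phi> p + \<phi> q"
    and \<phi>_scalar: "p \<in> A_plus \<Longrightarrow> \<phi> (scalar c * p) = c * \<phi> p"
    and \<phi>_q0: "p \<in> A_plus \<Longrightarrow> \<phi> (q0 * p) = tpow (- 1) * \<phi> p"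
    and \<phi>_Qhat_neg1: "p \<in> A_plus \<Longrightarrow> \<phi> (Qhat (- 1) * p) = 0"
begin

lemma \<phi>_diff: "p \<in> A_plus \<Longrightarrow> q \<in> A_plus \<Longrightarrow> \<phi> (p - q) = \<phi> p - \<phi> q"
  using \<phi>_add [of p "scalar (- 1) * q"] \<phi>_scalar [of q "- 1"]
    A_plus.mult [OF A_plus.scalar, of q "- 1"]
  by (simp add: scalar_uminus)

lemma vanishes_on_vacuum_span:
  assumes "\<And>k. k < n \<Longrightarrow> \<phi> (q1 ^ k) = 0" "x \<in> vacuum_span n"
  shows "\<phi> x = 0"
  using assms(2)
proof (induction rule: vacuum_span.induct)
  case (weight x)
  then have "\<phi> (q0 * x - tq_inv * x) = \<phi> (q0 * x) - \<phi> (tq_inv * x)"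
    by (intro \<phi>_diff A_plus_closed)
  then show ?case using weight by (simp add: \<phi>_q0 \<phi>_scalar)
qed (simp_all add: assms(1) \<phi>_Qhat_neg1 \<phi>_scalar \<phi>_add vacuum_span_in_A_plus)

lemma vanishes_if_powers:
  assumes "\<And>k. \<phi> (q1 ^ k) = 0" "p \<in> A_plus"
  shows "\<phi> p = 0"
proof -
  obtain n where "p \<in> vacuum_span n" using A_plus_vacuum_span [OF assms(2)] by blast
  with assms(1) show ?thesis by (rule vanishes_on_vacuum_span)
qed

text \<open>Triangularity passes the vanishing from the \<open>Qhat m\<close> to the powers of
  \<open>q1\<close>: at exponent \<open>k\<close> the remainder involves, modulo \<open>I\<close>,
  only smaller powers.\<close>

lemma vanishes_if_Qhat:
  assumes "\<And>m. \<phi> (Qhat (int m)) = 0" "p \<in> A_plus"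
  shows "\<phi> p = 0"
proof (rule vanishes_if_powers [OF _ assms(2)])
  fix k
  show "\<phi> (q1 ^ k) = 0"
  proof (induction k rule: less_induct)
    case (less k)
    obtain e where e: "Qhat (int k) - scalar (tpow e) * q1 ^ k \<in> vacuum_span k"
      using Qhat_leading_power by blast
    have "\<phi> (Qhat (int k) - scalar (tpow e) * q1 ^ k) = 0"
      by (rule vanishes_on_vacuum_span [OF less e])
    then show ?case
      by (simp add: \<phi>_diff \<phi>_scalar assms(1) A_plus_closed)
  qed
qed

end

section \<open>Constant terms with powers of the limit \<open>z\<close>\<close>

lemma coeff_qmono_mult:
  "coeff (qmono c a b * f) n = Poly_Mapping.single a c * twist b (coeff f (n - b))"
proof -
  have "coeff (qmono c a b * f) n
      = (\<Sum>i. (Poly_Mapping.single a c * twist b (coeff f (n - b)) when i = b))"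
    unfolding times_qseries.rep_eq coeff_qmono by (rule Sum_any.cong) (simp add: when_def)
  then show ?thesis by simp
qed

lemma lookup_single_mult:
  fixes p :: laurent_tq
  shows "Poly_Mapping.lookup (Poly_Mapping.single a c * p) k = c * Poly_Mapping.lookup p (k - a)"
proof -
  have "Poly_Mapping.lookup (Poly_Mapping.single a c) l * Poly_Mapping.lookup p (k - l)
      = (c * Poly_Mapping.lookup p (k - a) when l = a)" for l
    by (simp add: lookup_single when_def)
  then show ?thesis unfolding lookup_times_int by simp
qed

lemma CT_add: "CT_q1_at_q0_1 (f + g) = CT_q1_at_q0_1 f + CT_q1_at_q0_1 g"
  unfolding CT_q1_at_q0_1_def coeff_add lookup_add by (rule Sum_any.distrib) auto

text \<open>A power of Q_0 on the left only shifts exponents, and setting Q_0 = 1 forgets this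
  shift.\<close>

lemma CT_qmono_mult: "CT_q1_at_q0_1 (qmono c a 0 * f) = c * CT_q1_at_q0_1 f"
proof -
  let ?p = "Poly_Mapping.lookup (coeff f 0)"
  have "CT_q1_at_q0_1 (qmono c a 0 * f) = (\<Sum>k. c * ?p (k - a))"
    by (simp add: CT_q1_at_q0_1_def coeff_qmono_mult lookup_single_mult)
  also have "\<dots> = (\<Sum>k. c * ?p k)"
  proof (rule Sum_any.reindex_cong)
    show "bij (\<lambda>k. k + a)"
      by (rule bij_betw_byWitness [where f' = "\<lambda>k. k - a"]) auto
  qed (simp add: fun_eq_iff)
  also have "\<dots> = c * (\<Sum>k. ?p k)"
    by (rule Sum_any_right_distrib [symmetric]) simp
  finally show ?thesis by (simp add: CT_q1_at_q0_1_def)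
qed

lemma CT_scalar_mult: "CT_q1_at_q0_1 (scalar c * f) = c * CT_q1_at_q0_1 f"
  unfolding scalar_def by (rule CT_qmono_mult)

lemma CT_0: "coeff f 0 = 0 \<Longrightarrow> CT_q1_at_q0_1 f = 0"
  by (simp add: CT_q1_at_q0_1_def)

text \<open>Pulled to the left through \<open>q1 * q0_inv\<close>, \<open>q0\<close> becomes t^-1
  Q_0, while \<open>q1 * q0_inv * Qhat (- 1)\<close> collapses to Q_0 - Q_0^-1. At Q_0 = 1 these are
  t^-1 and 0.\<close>

lemma vacuum_functional_CT: "vacuum_functional (\<lambda>x. CT_q1_at_q0_1 (q1 * q0_inv * x * g))"
proof
  fix p q c
  show "CT_q1_at_q0_1 (q1 * q0_inv * (p + q) * g)
      = CT_q1_at_q0_1 (q1 * q0_inv * p * g) + CT_q1_at_q0_1 (q1 * q0_inv * q * g)"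
    by (simp add: distrib_left distrib_right CT_add)
  have "q1 * q0_inv * (scalar c * p) * g = scalar c * (q1 * q0_inv * p * g)"
    using scalar_left_commute [of "q1 * q0_inv"] by (simp only: mult.assoc)
  then show "CT_q1_at_q0_1 (q1 * q0_inv * (scalar c * p) * g) = c * CT_q1_at_q0_1 (q1 * q0_inv * p * g)"
    by (simp only: CT_scalar_mult)
  have "q1 * q0_inv * q0 = qmono (tpow (- 1)) 1 0 * (q1 * q0_inv)"
    by (simp add: torus_monomials qmono_mult flip: tpow_add)
  then have "q1 * q0_inv * (q0 * p) * g = qmono (tpow (- 1)) 1 0 * (q1 * q0_inv * p * g)"
    by (simp only: mult.assoc [symmetric])
  then show "CT_q1_at_q0_1 (q1 * q0_inv * (q0 * p) * g) = tpow (- 1) * CT_q1_at_q0_1 (q1 * q0_inv * p * g)"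
    by (simp only: CT_qmono_mult)
  have "q1 * q0_inv * Qhat (- 1) = qmono 1 1 0 + qmono (- 1) (- 1) 0"
    by (simp add: Qhat_neg1 qmono_uminus torus_monomials qmono_mult algebra_simps flip: tpow_add)
  then have "q1 * q0_inv * (Qhat (- 1) * p) * g
      = qmono 1 1 0 * (p * g) + qmono (- 1) (- 1) 0 * (p * g)"
    by (simp only: mult.assoc [symmetric] distrib_right)
  then show "CT_q1_at_q0_1 (q1 * q0_inv * (Qhat (- 1) * p) * g) = 0"
    by (simp add: CT_add CT_qmono_mult)
qed

section \<open>Limits and the degree of z\<close>

lemma zlim_limit: "qlim (\<lambda>k. Qhat (int k) * ring_inv (Qhat (int k + 1))) zlim"
  unfolding zlim_def by (rule theI' [OF zlim_exists])

lemma deg_le_Qhat_ratio: "deg_le (Qhat (int k) * ring_inv (Qhat (int k + 1))) (- 1)"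
proof -
  have "int k + 1 = int (Suc k)" by simp
  then have "deg_le (Qhat (int k) * ring_inv (Qhat (int k + 1))) (int k + - int (Suc k))"
    using deg_le_mult [OF _ Qhat_inverse(3)] Qhat_leading by metis
  then show ?thesis by (rule deg_le_mono) simp
qed

lemma deg_le_zlim: "deg_le zlim (- 1)"
  by (rule deg_le_qlim [OF zlim_limit deg_le_Qhat_ratio])

lemma qlim_shift: "qlim X f \<Longrightarrow> qlim (\<lambda>k. X (Suc k)) f"
  unfolding qlim_def by (meson le_Suc_eq le_SucI)

lemma qlim_add: "qlim X f \<Longrightarrow> qlim Y g \<Longrightarrow> qlim (\<lambda>k. X k + Y k) (f + g)"
  unfolding qlim_def
proof
  fix N
  assume "\<forall>N. \<exists>K. \<forall>k\<ge>K. deg_le (X k - f) N" "\<forall>N. \<exists>K. \<forall>k\<ge>K. deg_le (Y k - g) N"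
  then obtain K L where "\<forall>k\<ge>K. deg_le (X k - f) N" "\<forall>k\<ge>L. deg_le (Y k - g) N" by meson
  then have "\<forall>k\<ge>max K L. deg_le (X k + Y k - (f + g)) N"
    by (auto simp: deg_le_def)
  then show "\<exists>K. \<forall>k\<ge>K. deg_le (X k + Y k - (f + g)) N" ..
qed

text \<open>Split the error as (X k - f) Y k + f (Y k - g); the uniform degree bound on
  \<open>Y\<close> controls the first term.\<close>

lemma qlim_times:
  assumes "qlim X f" "qlim Y g" "\<And>k. deg_le (Y k) M"
  shows "qlim (\<lambda>k. X k * Y k) (f * g)"
proof -
  have "qlim (\<lambda>k. (X k - f) * Y k) 0"
    unfolding qlim_def
  proof
    fix N
    obtain K where "\<forall>k\<ge>K. deg_le (X k - f) (N - M)" using assms(1) by (auto simp: qlim_def)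
    then have "\<forall>k\<ge>K. deg_le ((X k - f) * Y k - 0) N"
      using deg_le_mult [OF _ assms(3)] by fastforce
    then show "\<exists>K. \<forall>k\<ge>K. deg_le ((X k - f) * Y k - 0) N" ..
  qed
  from qlim_add [OF this qlim_mult(1) [OF assms(2), of f]]
  show ?thesis by (simp add: left_diff_distrib)
qed

text \<open>Divide the linear recursion by \<open>Q\<^sub>k\<^sub>+\<^sub>2\<close> and pass to the limit.\<close>

lemma zlim_quadratic: "conserved * zlim = 1 + tq * (zlim * zlim)"
proof -
  define X where "X k = Qhat (int k) * ring_inv (Qhat (int k + 1))" for k
  have X: "qlim X zlim" "deg_le (X k) (- 1)" for k
    unfolding X_def using zlim_limit deg_le_Qhat_ratio by auto
  have step: "conserved * X (Suc k) = 1 + tq * (X k * X (Suc k))" for k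
  proof -
    define a b c where abc: "a = Qhat (int k)" "b = Qhat (int (Suc k))" "c = Qhat (int (Suc (Suc k)))"
    have idx: "int k + 1 = int (Suc k)" "int (Suc k) + 1 = int (Suc (Suc k))" by simp_all
    have inv: "ring_inv b * b = 1" "c * ring_inv c = 1"
      unfolding abc by (rule Qhat_inverse)+
    have "conserved * b = c + tq * a"
      using Qhat_linear [of "int (Suc k)"] unfolding abc by (simp add: add.commute)
    then have "conserved * b * ring_inv c = 1 + tq * (a * ring_inv c)"
      by (simp add: distrib_right inv mult.assoc)
    moreover have "a * ring_inv c = a * ring_inv b * (b * ring_inv c)"
      by (metis inv(1) mult.assoc mult.right_neutral)
    ultimately show ?thesis
      unfolding X_def idx abc [symmetric] by (simp add: mult.assoc)
  qed
  have "qlim (\<lambda>k. 1) (1 :: qseries)"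
    by (simp add: qlim_def deg_le_def)
  then have "qlim (\<lambda>k. 1 + tq * (X k * X (Suc k))) (1 + tq * (zlim * zlim))"
    by (intro qlim_add qlim_mult(1) qlim_times [OF X(1) qlim_shift [OF X(1)] X(2)])
  moreover have "qlim (\<lambda>k. conserved * X (Suc k)) (conserved * zlim)"
    by (intro qlim_mult(1) qlim_shift X)
  ultimately show ?thesis unfolding step by (rule qlim_unique [symmetric])
qed

lemma deg_le_zlim_power: "deg_le (zlim ^ k) (- int k)"
proof (induction k)
  case 0
  then show ?case by (simp add: deg_le_def coeff_1)
next
  case (Suc k)
  from deg_le_mult [OF deg_le_zlim Suc] show ?case by simp
qed

lemma deg_le_q1: "deg_le q1 1"
  by (simp add: q1_def deg_le_qmono)

lemma CT_q1_zlim_power: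
  "CT_q1_at_q0_1 (q1 * zlim ^ k) = (if k = 1 then tpow (- 1) else 0)"
proof -
  consider "k = 0" | "k = 1" | "k > 1" by linarith
  then show ?thesis
  proof cases
    case 1
    then show ?thesis by (simp add: CT_0 q1_def coeff_qmono)
  next
    case 2
    \<comment> \<open>In degree 0 of \<open>conserved * zlim\<close> only the two top terms meet,
      and the quadratic equation leaves the constant 1 there. This determines the leading
      coefficient of z.\<close>
    have "deg_le conserved 1"
      unfolding conserved_monomials
      by (intro deg_le_add deg_le_diff deg_le_mono [OF deg_le_qmono]) auto
    from coeff_mult_top [OF this deg_le_zlim]
    have "coeff (conserved * zlim) 0 = coeff (qmono (tpow 1) (- 1) 0 * (q1 * zlim)) 0"
      by (simp add: coeff_qmono_mult q1_def conserved_monomials coeff_qmono)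
    moreover have "deg_le (tq * (zlim * zlim)) (0 + (- 1 + - 1))"
      unfolding scalar_def by (intro deg_le_mult deg_le_zlim deg_le_qmono)
    then have "coeff (conserved * zlim) 0 = coeff 1 0"
      by (simp add: zlim_quadratic deg_le_def)
    ultimately have "tpow 1 * CT_q1_at_q0_1 (q1 * zlim) = CT_q1_at_q0_1 1"
      using CT_qmono_mult [of "tpow 1" "- 1" "q1 * zlim"] by (simp add: CT_q1_at_q0_1_def)
    moreover have "CT_q1_at_q0_1 1 = 1"
      by (simp add: CT_q1_at_q0_1_def coeff_1 lookup_one)
    ultimately have "tpow (- 1) * (tpow 1 * CT_q1_at_q0_1 (q1 * zlim)) = tpow (- 1)"
      by simp
    then show ?thesis using 2 by (simp flip: mult.assoc tpow_add)
  next
    case 3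
    then have "deg_le (q1 * zlim ^ k) (- 1)"
      using deg_le_mult [OF deg_le_q1 deg_le_zlim_power [of k]] by (elim deg_le_mono) simp
    then show ?thesis using 3 by (simp add: CT_0 deg_le_def)
  qed
qed

text \<open>Starting the induction at \<open>Q\<^sub>-\<^sub>1\<close> and at the exponent \<open>0\<close> of \<open>z\<close>, i.e. at \<open>\<mu>\<^sub>-\<^sub>1\<close>, makes the
  three-term recursion valid without boundary cases.\<close>

lemma mu_Qhat: "mu l (Qhat (int m)) = (if m = l then tpow (- int m - 1) else 0)"
proof -
  define f where "f k x = CT_q1_at_q0_1 (q1 * q0_inv * x * zlim ^ k)" for k x
  interpret f: vacuum_functional "f k" for k
    unfolding f_def by (rule vacuum_functional_CT)
  \<comment> \<open>Without a factor z, a power of \<open>q1\<close> contributes only positive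
    exponents of Q_1.\<close>
  have f_0: "f 0 x = 0" if "x \<in> A_plus" for x
  proof (rule f.vanishes_if_powers [OF _ that])
    fix k
    have "f 0 (q1 ^ k) = tpow 1 * CT_q1_at_q0_1 (q1 * q1 ^ k)"
      unfolding f_def q1_q0_inv
      by (simp add: mult.assoc CT_scalar_mult CT_qmono_mult [of 1, simplified] q0_inv_def)
    also have "q1 * q1 ^ k = qmono 1 0 (1 + int k)"
    proof (induction k)
      case (Suc k)
      then show ?case by (simp add: q1_def qmono_mult)
    qed (simp add: q1_def)
    also have "CT_q1_at_q0_1 \<dots> = 0"
      by (rule CT_0) (simp add: coeff_qmono)
    finally show "f 0 (q1 ^ k) = 0" by simp
  qed
  \<comment> \<open>Absorbing \<open>conserved\<close> into the power of z turns the recursion for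
    the \<open>Qhat j\<close> into a recursion in the exponent of z.\<close>
  have f_conserved: "f (Suc k) (x * conserved) = f k x + tpow 1 * f (Suc (Suc k)) x" for k x
  proof -
    have "x * conserved * zlim ^ Suc k = x * (conserved * zlim) * zlim ^ k"
      by (simp add: mult.assoc)
    also have "\<dots> = x * zlim ^ k + tq * (x * zlim ^ Suc (Suc k))"
      unfolding zlim_quadratic by (simp add: distrib_left distrib_right mult.assoc scalar_left_commute [of x])
    finally have "q1 * q0_inv * (x * conserved) * zlim ^ Suc k
        = q1 * q0_inv * x * zlim ^ k + tq * (q1 * q0_inv * x * zlim ^ Suc (Suc k))"
      by (simp only: mult.assoc distrib_left scalar_left_commute [of q1] scalar_left_commute [of q0_inv])
    then show ?thesis unfolding f_def by (simp only: CT_add CT_scalar_mult)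
  qed
  \<comment> \<open>The index \<open>j\<close> is an integer so that \<open>j = - 1\<close> is
    allowed; it equals no \<open>int l\<close>, so the value there is 0.\<close>
  define D where "D j l = (if j = int l then tpow (- j - 1) else 0)" for j l
  have "(\<forall>l. f (Suc l) (Qhat (int m - 1)) = D (int m - 1) l) \<and> (\<forall>l. f (Suc l) (Qhat (int m)) = D (int m) l)"
  proof (induction m)
    case 0
    have "f (Suc l) (Qhat (- 1)) = 0" for l
      using f.\<phi>_Qhat_neg1 [of 1] by (simp add: A_plus_closed)
    moreover have "f (Suc l) q0 = CT_q1_at_q0_1 (q1 * zlim ^ Suc l)" for l
      by (simp add: f_def mult.assoc q0_inverse)
    ultimately show ?case by (auto simp: D_def CT_q1_zlim_power simp del: power_Suc)
  next
    case (Suc m)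
    have A: "Qhat (int m - 1) \<in> A_plus" "Qhat (int m) \<in> A_plus" "Qhat (int (Suc m)) \<in> A_plus"
      by (cases m; auto intro: A_plus_closed)+
    have "f (Suc l) (Qhat (int (Suc m))) = D (int (Suc m)) l" for l
    proof -
      have "Qhat (int m) * conserved = tq * Qhat (int (Suc m)) + Qhat (int m - 1)"
        using Qhat_linear_right [of "int m"] by (simp add: add.commute)
      then have "f l (Qhat (int m)) + tpow 1 * f (Suc (Suc l)) (Qhat (int m))
          = tpow 1 * f (Suc l) (Qhat (int (Suc m))) + f (Suc l) (Qhat (int m - 1))"
        using A f_conserved [of l "Qhat (int m)"] by (simp add: f.\<phi>_add f.\<phi>_scalar A_plus_closed)
      then have "tpow (- 1) * (tpow 1 * f (Suc l) (Qhat (int (Suc m))))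
        = tpow (- 1) * (f l (Qhat (int m)) + tpow 1 * D (int m) (Suc l) - D (int m - 1) l)"
        using Suc by (simp add: algebra_simps)
      \<comment> \<open>For \<open>l = 0\<close> this is \<open>f_0\<close>; otherwise it is the
        induction hypothesis at \<open>l - 1\<close>.\<close>
      moreover have "f l (Qhat (int m)) = (if int m + 1 = int l then tpow (- int m - 1) else 0)"
        using Suc A f_0 by (cases l) (auto simp: D_def)
      ultimately show ?thesis
        by (auto simp: D_def right_diff_distrib simp flip: mult.assoc tpow_add
            intro!: arg_cong [where f = tpow])
    qed
    then show ?case using Suc by simp
  qed
  then show ?thesis by (simp add: f_def D_def mu_def)
qed

section \<open>The weight vectors of the representation\<close>

context cyclic_rep
begin

sublocale ket: module_hom scale "(*)" "ket l" for l
  by (rule ket_hom)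

lemma act_0_left: "p \<in> A_plus \<Longrightarrow> act 0 p = 0"
  using act_scale_left [of p 0 0] by simp

lemma act_scalar_mult: "p \<in> A_plus \<Longrightarrow> act v (scalar c * p) = scale c (act v p)"
  by (simp add: act_mult act_scalar act_scale_left A_plus_closed)

lemma act_1: "act v 1 = v"
  using act_scalar [of v 1] by simp

lemma act_diff_right:
  assumes "p \<in> A_plus" "q \<in> A_plus"
  shows "act v (p - q) = act v p - act v q"
proof -
  have "act v ((p - q) + q) = act v (p - q) + act v q"
    using assms by (intro act_add_right A_plus_closed)
  then show ?thesis by simp
qed

section \<open>Coordinates in the basis of the \<open>bra m\<close>\<close>

lemma bra_span_finite: "\<exists>N. v \<in> span (bra ` {..<N})"
proof -
  have "v \<in> span (range bra)" by (simp add: bra_span)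
  then show ?thesis
  proof (induction rule: span_induct_alt)
    case base
    then show ?case by (auto intro: span_zero)
  next
    case (step c x y)
    then obtain m N where "x = bra m" "y \<in> span (bra ` {..<N})" by blast
    moreover have "span (bra ` {..<N}) \<subseteq> span (bra ` {..<max (Suc m) N})"
      by (intro span_mono image_mono) auto
    ultimately have "scale c x + y \<in> span (bra ` {..<max (Suc m) N})"
      by (intro span_add span_scale) (auto intro: span_base)
    then show ?case ..
  qed
qed

lemma span_bra_Suc:
  assumes "v \<in> span (bra ` {..<Suc N})"
  obtains c where "v - scale c (bra N) \<in> span (bra ` {..<N})"
  using assms by (auto simp: lessThan_Suc span_breakdown_eq)

text \<open>In a combination of the first \<open>Suc N\<close> basis vectors, \<open>ket N\<close>
  reads off the last coefficient; descend on the length.\<close>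

lemma ket_eq_0:
  assumes "\<And>l. ket l v = 0"
  shows "v = 0"
proof -
  have low: "ket N w = 0" if "w \<in> span (bra ` {..<N})" for N w
    using that
    by (induction rule: span_induct_alt) (auto simp: ket.add ket.scale ket_bra)
  obtain N where "v \<in> span (bra ` {..<N})" using bra_span_finite by blast
  then show ?thesis
  proof (induction N)
    case (Suc N)
    then obtain c where c: "v - scale c (bra N) \<in> span (bra ` {..<N})"
      using span_bra_Suc by blast
    then have "c = 0"
      using low [OF c] assms by (simp add: ket.diff ket.scale ket_bra)
    then show ?case using Suc.IH c by simp
  qed simp
qed

text \<open>The coordinates separate vectors and take values in a ring without zero
  divisors.\<close>

lemma torsion_free: "scale c v = 0 \<Longrightarrow> c = 0 \<or> v = 0"
  using ket_eq_0 ket.scale by (metis ket.zero mult_eq_0_iff)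

section \<open>Weight vectors of \<open>q0\<close>\<close>

definition weight :: "int \<Rightarrow> 'v \<Rightarrow> bool"
  where "weight j v \<longleftrightarrow> act v q0 = scale (tpow j) v"

lemma weight_q1: "weight j v \<Longrightarrow> weight (j - 1) (act v q1)"
proof -
  assume "weight j v"
  have "act (act v q1) q0 = act v (tq_inv * (q0 * q1))"
    by (simp add: q1_q0 mult.assoc A_plus_closed flip: act_mult)
  also have "\<dots> = scale (tpow (- 1)) (act (act v q0) q1)"
    by (simp add: act_scalar_mult A_plus_closed flip: act_mult)
  also have "\<dots> = scale (tpow (j - 1)) (act v q1)"
    using \<open>weight j v\<close> by (simp add: weight_def act_scale_left A_plus_closed add.commute flip: tpow_add)
  finally show ?thesis by (simp add: weight_def)
qed

lemma weight_Qhat_neg1: "weight j v \<Longrightarrow> weight (j + 1) (act v (Qhat (- 1)))"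
proof -
  assume "weight j v"
  have "act (act v (Qhat (- 1))) q0 = act v (tq * (q0 * Qhat (- 1)))"
    by (simp add: Qhat_neg1_q0 mult.assoc A_plus_closed flip: act_mult)
  also have "\<dots> = scale (tpow 1) (act (act v q0) (Qhat (- 1)))"
    by (simp add: act_scalar_mult A_plus_closed flip: act_mult)
  also have "\<dots> = scale (tpow (j + 1)) (act v (Qhat (- 1)))"
    using \<open>weight j v\<close> by (simp add: weight_def act_scale_left A_plus_closed add.commute flip: tpow_add)
  finally show ?thesis by (simp add: weight_def)
qed

lemma weight_q0_inv:
  assumes "weight j v"
  shows "act v q0_inv = scale (tpow (- j)) v"
proof -
  have "v = act (act v q0) q0_inv"
    by (simp add: A_plus_closed q0_inverse act_1 flip: act_mult)
  then have "v = scale (tpow j) (act v q0_inv)"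
    using assms by (simp add: weight_def act_scale_left A_plus_closed)
  then have "scale (tpow (- j)) v = scale (tpow (- j) * tpow j) (act v q0_inv)"
    by (metis scale_scale)
  then show ?thesis by (simp flip: tpow_add)
qed

lemma weight_q0_q0: "weight j v \<Longrightarrow> act v (q0 * q0) = scale (tpow (2 * j)) v"
  by (simp add: weight_def act_mult act_scale_left A_plus_closed flip: tpow_add)

lemma weight_q1_Qhat_neg1:
  assumes "weight j v"
  shows "act (act v q1) (Qhat (- 1)) = scale (tpow (- 1) * (tpow (2 * j) - 1)) v"
proof -
  have "act (act v q1) (Qhat (- 1)) = act v (tq_inv * (q0 * q0 - 1))"
    by (simp add: q1_Qhat_neg1 A_plus_closed flip: act_mult)
  also have "\<dots> = scale (tpow (- 1)) (act v (q0 * q0) - v)"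
    by (simp add: act_scalar_mult act_diff_right act_1 A_plus_closed)
  finally show ?thesis using assms by (simp add: weight_q0_q0 algebra_simps)
qed

lemma weight_Qhat_neg1_q1:
  assumes "weight j v"
  shows "act (act v (Qhat (- 1))) q1 = scale (tpow 1 * tpow (2 * j) - tpow (- 1)) v"
proof -
  have "act (act v (Qhat (- 1))) q1 = act v (tq * (q0 * q0) - tq_inv)"
    by (simp add: Qhat_neg1_q1 A_plus_closed flip: act_mult)
  also have "\<dots> = scale (tpow 1) (act v (q0 * q0)) - scale (tpow (- 1)) v"
    by (simp add: act_scalar_mult act_diff_right act_scalar A_plus_closed)
  finally show ?thesis using assms by (simp add: weight_q0_q0 algebra_simps)
qed

text \<open>The string through the vacuum is kept two-sided, since \<open>wt (- 1) = 0\<close> is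
  only established at the end. The exponent of the weight of \<open>wt k\<close> is
  \<open>- k - 1\<close> on both sides.\<close>

definition wt :: "int \<Rightarrow> 'v"
  where "wt k = (if k \<ge> 0 then ((\<lambda>v. act v q1) ^^ nat k) (bra 0)
    else ((\<lambda>v. act v (Qhat (- 1))) ^^ nat (- k)) (bra 0))"

lemma wt_0: "wt 0 = bra 0"
  by (simp add: wt_def)

lemma wt_up: "k \<ge> 0 \<Longrightarrow> wt (k + 1) = act (wt k) q1"
  by (simp add: wt_def nat_add_distrib)

lemma wt_down:
  assumes "k \<le> 0"
  shows "wt (k - 1) = act (wt k) (Qhat (- 1))"
proof -
  have "nat (- (k - 1)) = Suc (nat (- k))" using assms by simp
  then show ?thesis using assms by (cases "k = 0") (simp_all add: wt_def)
qed

lemma weight_wt: "weight (- k - 1) (wt k)"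
proof (induction k rule: int_induct [where k = 0])
  case base
  then show ?case using bra_0_q0 by (simp add: weight_def wt_0)
next
  case (step1 i)
  then show ?case using weight_q1 [of "- i - 1" "wt i"] by (simp add: wt_up)
next
  case (step2 i)
  then show ?case using weight_Qhat_neg1 [of "- i - 1" "wt i"] by (simp add: wt_down)
qed

text \<open>Against the direction of construction, \<open>Qhat (- 1)\<close> followed by
  \<open>q1\<close> is a polynomial in \<open>q0\<close>, which acts on a weight vector by a
  scalar.\<close>

lemma act_wt_q1: "\<exists>c. act (wt k) q1 = scale c (wt (k + 1))"
proof (cases "k \<ge> 0")
  case True
  then have "act (wt k) q1 = scale 1 (wt (k + 1))" by (simp add: wt_up)
  then show ?thesis ..
next
  case False
  then have "wt k = act (wt (k + 1)) (Qhat (- 1))" using wt_down [of "k + 1"] by simp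
  then show ?thesis using weight_Qhat_neg1_q1 [OF weight_wt [of "k + 1"]] by auto
qed

lemma act_wt_Qhat_neg1: "\<exists>c. act (wt k) (Qhat (- 1)) = scale c (wt (k - 1))"
proof (cases "k \<le> 0")
  case True
  then have "act (wt k) (Qhat (- 1)) = scale 1 (wt (k - 1))" by (simp add: wt_down)
  then show ?thesis ..
next
  case False
  then have "wt k = act (wt (k - 1)) q1" using wt_up [of "k - 1"] by simp
  then show ?thesis using weight_q1_Qhat_neg1 [OF weight_wt [of "k - 1"]] by auto
qed

text \<open>\<open>Qhat (- 1)\<close> maps \<open>wt (n + 1)\<close> back to \<open>wt n\<close>
  times t^-1 (t^(-2n-2) - 1), a nonzero scalar, so no vector of the ascending string can
  vanish.\<close>

lemma wt_neq_0: "wt (int n) \<noteq> 0"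
proof (induction n)
  case 0
  have "ket 0 (bra 0) \<noteq> ket 0 0" by (simp add: ket_bra)
  then show ?case by (auto simp: wt_0)
next
  case (Suc n)
  let ?c = "tpow (- 1) * (tpow (2 * (- int n - 1)) - 1)"
  have "tpow (2 * (- int n - 1)) \<noteq> tpow 0" unfolding tpow_eq_iff by simp
  then have "scale ?c (wt (int n)) \<noteq> 0"
    using Suc torsion_free [of ?c "wt (int n)"] by auto
  moreover have "act (wt (int (Suc n))) (Qhat (- 1)) = scale ?c (wt (int n))"
    using weight_q1_Qhat_neg1 [OF weight_wt, of "int n"] wt_up [of "int n"] by (simp add: add.commute)
  ultimately show ?case using act_0_left [OF Qhat_neg1_in_A_plus] by auto
qed

section \<open>Triangularity of the basis against the weight vectors\<close>

lemma span_wt_mono: "v \<in> span (wt ` {..m}) \<Longrightarrow> m \<le> n \<Longrightarrow> v \<in> span (wt ` {..n})"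
  using span_mono [OF image_mono, of "{..m}" "{..n}" wt] by auto

lemma span_wt_act:
  assumes "y \<in> A_plus" "\<And>k. \<exists>c. act (wt k) y = scale c (wt (k + d))" "v \<in> span (wt ` {..n})"
  shows "act v y \<in> span (wt ` {..n + d})"
  using assms(3)
proof (induction rule: span_induct_alt)
  case base
  then show ?case by (simp add: act_0_left assms(1) span_zero)
next
  case (step c x w)
  then obtain k where k: "x = wt k" "k \<le> n" by auto
  obtain b where "act (wt k) y = scale b (wt (k + d))" using assms(2) by blast
  then have "act (scale c x + w) y = scale c (scale b (wt (k + d))) + act w y"
    by (simp only: act_add_left act_scale_left assms(1) k)
  also have "\<dots> \<in> span (wt ` {..n + d})"
    using step k by (intro span_add span_scale) (auto intro: span_base)
  finally show ?case .
qed

lemma span_wt_q1: "v \<in> span (wt ` {..n}) \<Longrightarrow> act v q1 \<in> span (wt ` {..n + 1})"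
  by (rule span_wt_act [OF q1_in_A_plus act_wt_q1])

lemma span_wt_Qhat_neg1: "v \<in> span (wt ` {..n}) \<Longrightarrow> act v (Qhat (- 1)) \<in> span (wt ` {..n - 1})"
  using span_wt_act [of "Qhat (- 1)" "- 1"] act_wt_Qhat_neg1 by (simp add: A_plus_closed)

lemma span_wt_q0_inv: "v \<in> span (wt ` {..n}) \<Longrightarrow> act v q0_inv \<in> span (wt ` {..n})"
  using span_wt_act [of q0_inv 0] weight_q0_inv [OF weight_wt] by (auto intro: A_plus_closed)

lemma act_conserved:
  "act v conserved = scale (tpow 1) (act (act v q0_inv) q1) + act (act v q0_inv) (Qhat (- 1))"
  by (simp add: conserved_eq act_mult [of q0_inv] act_add_right act_scalar_mult A_plus_closed)

lemma span_wt_conserved: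
  assumes "v \<in> span (wt ` {..n})"
  shows "act v conserved \<in> span (wt ` {..n + 1})"
  unfolding act_conserved
  by (intro span_add span_scale span_wt_q1 span_wt_q0_inv assms
      span_wt_mono [OF span_wt_Qhat_neg1 [OF span_wt_q0_inv [OF assms]]]) simp

text \<open>The counterpart of \<open>Qhat_leading_power\<close> inside the representation. The
  error terms range over all smaller integers, negative ones included, because
  \<open>Qhat (- 1)\<close> is not yet known to kill the vacuum.\<close>

lemma act_bra_0_Qhat_leading:
  "\<exists>e. act (bra 0) (Qhat (int m)) - scale (tpow e) (wt (int m)) \<in> span (wt ` {..int m - 1})"
proof (induction m rule: induct_nat_012)
  case 0
  show ?case by (auto simp: bra_0_q0 wt_0 span_zero intro: exI [of _ "- 1"])
next
  case 1
  show ?case using wt_up [of 0] by (auto simp: wt_0 span_zero intro: exI [of _ 0])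
next
  case (ge2 n)
  let ?N = "int (Suc (Suc n))"
  let ?S = "span (wt ` {..?N - 1})"
  let ?v = "\<lambda>k. act (bra 0) (Qhat k)"
  have mem: "?v (int k) \<in> span (wt ` {..int k})"
    if "?v (int k) - scale (tpow e) (wt (int k)) \<in> span (wt ` {..int k - 1})" for k e
    using span_add [OF span_wt_mono [OF that, of "int k"] span_scale [OF span_base], of "wt (int k)" "tpow e"]
    by simp
  obtain e where e: "?v (int (Suc n)) - scale (tpow e) (wt (int (Suc n))) \<in> span (wt ` {..int (Suc n) - 1})"
    using ge2 by blast
  define r where "r = ?v (int (Suc n)) - scale (tpow e) (wt (int (Suc n)))"
  have "?v (int n) \<in> span (wt ` {..int n})" using ge2(1) mem by blast
  then have vn: "?v (int n) \<in> ?S" by (rule span_wt_mono) simp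
  have rC: "act r conserved \<in> ?S"
    using span_wt_conserved [OF e] by (simp add: r_def add.commute)
  have low: "act (wt (int (Suc n))) (Qhat (- 1)) \<in> ?S"
    by (rule span_wt_mono [OF span_wt_Qhat_neg1 [OF span_base]]) auto
  have top: "act (wt (int (Suc n))) q1 = wt ?N"
    using wt_up [of "int (Suc n)"] by (simp add: add.commute)
  \<comment> \<open>The scalar by which \<open>q0_inv\<close> acts on \<open>wt (n + 1)\<close>,
    whose \<open>q0\<close>-eigenvalue is t^(-n-2).\<close>
  define a where "a = tpow (int n + 2)"
  have "act (wt (int (Suc n))) q0_inv = scale a (wt (int (Suc n)))"
    using weight_q0_inv [OF weight_wt [of "int (Suc n)"]] by (simp add: a_def add.commute)
  then have wtC: "act (wt (int (Suc n))) conserved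
      = scale (tpow 1 * a) (wt ?N) + scale a (act (wt (int (Suc n))) (Qhat (- 1)))"
    unfolding act_conserved by (simp only: act_scale_left A_plus_closed top scale_scale)
  have "act (?v (int (Suc n))) conserved = act (bra 0) (tq * Qhat ?N + Qhat (int n))"
    using Qhat_linear_right [of "int (Suc n)"]
    by (simp add: A_plus_closed algebra_simps flip: act_mult)
  also have "\<dots> = scale (tpow 1) (?v ?N) + ?v (int n)"
    by (simp add: act_add_right act_scalar_mult Qhat_nat_in_A_plus A_plus.mult A_plus.scalar del: of_nat_Suc)
  finally have "scale (tpow 1) (?v ?N) = act (?v (int (Suc n))) conserved - ?v (int n)"
    by simp
  also have "?v (int (Suc n)) = r + scale (tpow e) (wt (int (Suc n)))"
    by (simp add: r_def)
  also have "act \<dots> conserved = act r conserved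
      + scale (tpow e) (scale (tpow 1 * a) (wt ?N) + scale a (act (wt (int (Suc n))) (Qhat (- 1))))"
    by (simp only: act_add_left act_scale_left conserved_in_A_plus wtC)
  finally have "scale (tpow (- 1)) (scale (tpow 1) (?v ?N)) - scale (tpow (- 1) * (tpow e * (tpow 1 * a))) (wt ?N)
      = scale (tpow (- 1)) (act r conserved
        + scale (tpow e) (scale a (act (wt (int (Suc n))) (Qhat (- 1)))) - ?v (int n))"
    by (simp add: scale_right_distrib scale_right_diff_distrib)
  also have "\<dots> \<in> ?S"
    by (intro span_scale span_add span_diff rC low vn)
  also have "tpow (- 1) * (tpow e * (tpow 1 * a)) = tpow (e + int n + 2)"
    by (simp add: a_def add_ac flip: tpow_add)
  also have "scale (tpow (- 1)) (scale (tpow 1) (?v ?N)) = ?v ?N"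
    by (simp flip: tpow_add)
  finally show ?case by blast
qed

lemma bra_leading: "\<exists>e. bra m - scale (tpow e) (wt (int m)) \<in> span (wt ` {..int m - 1})"
proof (cases "m = 0")
  case True
  then show ?thesis by (auto simp: wt_0 span_zero intro: exI [of _ 0])
next
  case False
  obtain e where "act (bra 0) (Qhat (int m)) - scale (tpow e) (wt (int m)) \<in> span (wt ` {..int m - 1})"
    using act_bra_0_Qhat_leading by blast
  from span_scale [OF this, of "tpow (int m + 1)"] show ?thesis
    using bra_Qhat [of m] False
    by (auto simp: scale_right_diff_distrib simp flip: tpow_add)
qed

lemma bra_in_span_wt: "bra m \<in> span (wt ` {..int m})"
proof -
  obtain e where "bra m - scale (tpow e) (wt (int m)) \<in> span (wt ` {..int m - 1})"
    using bra_leading by blast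
  from span_add [OF span_wt_mono [OF this, of "int m"] span_scale [OF span_base], of "wt (int m)" "tpow e"]
  show ?thesis by simp
qed

text \<open>Eigenvectors for distinct eigenvalues: \<open>D\<close>, the action of \<open>q0\<close>
  minus the eigenvalue of \<open>wt s\<close>, kills \<open>wt s\<close> and multiplies
  \<open>c\<close> by the nonzero \<open>d n\<close>. Coefficients cannot be normalised over Laurent
  polynomials, so a multiple of \<open>wt n\<close> is considered.\<close>

lemma weight_vectors_independent:
  assumes "finite S" "n \<notin> S" "wt n \<noteq> 0" "scale c (wt n) \<in> span (wt ` S)"
  shows "c = 0"
  using assms(1,2,4)
proof (induction S arbitrary: c)
  case empty
  then show ?case using torsion_free assms(3) by auto
next
  case (insert s S)
  define d where "d k = tpow (- k - 1) - tpow (- s - 1)" for k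
  define D where "D v = act v q0 - scale (tpow (- s - 1)) v" for v
  have D_add: "D (v + w) = D v + D w" and D_scale: "D (scale b v) = scale b (D v)" for v w b
    by (simp_all add: D_def act_add_left act_scale_left A_plus_closed algebra_simps scale_left_commute)
  have D_wt: "D (wt k) = scale (d k) (wt k)" for k
    using weight_wt [of k] by (simp add: weight_def D_def d_def scale_left_diff_distrib)
  have D_span: "D v \<in> span (wt ` S)" if "v \<in> span (wt ` S)" for v
    using that
  proof (induction rule: span_induct_alt)
    case base
    then show ?case using D_scale [of 0 0] by (simp add: span_zero)
  next
    case (step b x y)
    then obtain k where k: "k \<in> S" "x = wt k" by blast
    have "scale b (scale (d k) (wt k)) + D y \<in> span (wt ` S)"
      by (rule span_add [OF _ step(2)]) (intro span_scale span_base imageI k(1))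
    then show ?case by (simp only: D_add D_scale D_wt k)
  qed
  obtain k where "scale c (wt n) - scale k (wt s) \<in> span (wt ` S)"
    using insert.prems by (auto simp: span_breakdown_eq)
  from D_span [OF this] have "scale (c * d n) (wt n) \<in> span (wt ` S)"
    using D_add [of "scale c (wt n) - scale k (wt s)" "scale k (wt s)"]
    by (simp add: D_scale D_wt) (simp add: d_def)
  then have "c * d n = 0" using insert by blast
  moreover have "d n \<noteq> 0" using insert.prems by (simp add: d_def tpow_eq_iff)
  ultimately show ?case by simp
qed

lemma scale_wt_in_lower_span:
  assumes "scale c (wt n) \<in> span (wt ` {..n - 1})" "wt n \<noteq> 0"
  shows "c = 0"
proof -
  obtain T r where T: "finite T" "T \<subseteq> wt ` {..n - 1}" "scale c (wt n) = (\<Sum>a\<in>T. scale (r a) a)"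
    using assms(1) unfolding span_explicit by blast
  then obtain S where S: "S \<subseteq> {..n - 1}" "finite S" "T = wt ` S"
    by (meson finite_subset_image)
  have "scale c (wt n) \<in> span (wt ` S)"
    unfolding T(3) S(3) by (intro span_sum span_scale span_base)
  moreover have "n \<notin> S" using S(1) by auto
  ultimately show ?thesis using weight_vectors_independent S(2) assms(2) by blast
qed

text \<open>Expanded in weight vectors, a nonzero combination of the \<open>\<langle>m|\<close> has a nonzero
  component of some weight \<open>t\<^sup>-\<^sup>m\<^sup>-\<^sup>1\<close>, whereas \<open>\<langle>0|Q\<^sub>-\<^sub>1\<close> has weight \<open>1\<close>.\<close>

lemma act_bra_0_Qhat_neg1: "act (bra 0) (Qhat (- 1)) = 0"
proof -
  define w where "w = wt (- 1)"
  obtain N where "w \<in> span (bra ` {..<N})" using bra_span_finite by blast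
  \<comment> \<open>Shorten the expansion of \<open>w\<close> in the basis one vector at a
    time.\<close>
  then have "w = 0"
  proof (induction N)
    case (Suc N)
    obtain c where c: "w - scale c (bra N) \<in> span (bra ` {..<N})"
      using Suc.prems span_bra_Suc by blast
    obtain e where e: "bra N - scale (tpow e) (wt (int N)) \<in> span (wt ` {..int N - 1})"
      using bra_leading by blast
    have "span (bra ` {..<N}) \<subseteq> span (wt ` {..int N - 1})"
      by (rule span_minimal) (auto intro: span_wt_mono [OF bra_in_span_wt])
    with c have "w - scale c (bra N) \<in> span (wt ` {..int N - 1})" by blast
    moreover have "w \<in> span (wt ` {..int N - 1})"
      unfolding w_def by (intro span_base) auto
    \<comment> \<open>The difference telescopes to \<open>scale (c * tpow e) (wt (int N))\<close>,
      which isolates the top coefficient \<open>c\<close>.\<close>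
    ultimately have "w - (w - scale c (bra N)) - scale c (bra N - scale (tpow e) (wt (int N)))
        \<in> span (wt ` {..int N - 1})"
      by (intro span_diff [OF span_diff] span_scale [OF e])
    then have "scale (c * tpow e) (wt (int N)) \<in> span (wt ` {..int N - 1})"
      by (simp add: scale_right_diff_distrib)
    then have "c * tpow e = 0" using wt_neq_0 by (rule scale_wt_in_lower_span)
    then have "c = 0" by simp
    then show ?case using Suc.IH c by simp
  qed simp
  then show ?thesis using wt_down [of 0] by (simp add: w_def wt_0)
qed

section \<open>Comparison of the two functionals\<close>

lemma vacuum_functional_ket: "vacuum_functional (\<lambda>p. ket l (act (bra 0) p))"
proof
  show "ket l (act (bra 0) (q0 * p)) = tpow (- 1) * ket l (act (bra 0) p)" if "p \<in> A_plus" for p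
    using that by (simp add: act_mult bra_0_q0 act_scale_left ket.scale A_plus_closed)
  show "ket l (act (bra 0) (Qhat (- 1) * p)) = 0" if "p \<in> A_plus" for p
    using that by (simp add: act_mult act_bra_0_Qhat_neg1 act_0_left A_plus_closed)
qed (simp_all add: act_add_right act_scalar_mult ket.add ket.scale)

lemma ket_Qhat: "ket l (act (bra 0) (Qhat (int m))) = (if m = l then tpow (- int m - 1) else 0)"
proof (cases "m = 0")
  case True
  then show ?thesis by (simp add: bra_0_q0 ket.scale ket_bra)
next
  case False
  then have "scale (tpow (- int m - 1)) (bra m) = act (bra 0) (Qhat (int m))"
    by (simp add: bra_Qhat flip: tpow_add)
  then have "ket l (act (bra 0) (Qhat (int m))) = tpow (- int m - 1) * ket l (bra m)"
    by (metis ket.scale)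
  then show ?thesis by (simp add: ket_bra)
qed

end

lemma vacuum_functional_diff:
  assumes "vacuum_functional \<phi>" "vacuum_functional \<psi>"
  shows "vacuum_functional (\<lambda>x. \<phi> x - \<psi> x)"
proof -
  interpret \<phi>: vacuum_functional \<phi> by fact
  interpret \<psi>: vacuum_functional \<psi> by fact
  show ?thesis
    by standard
      (simp_all add: \<phi>.\<phi>_add \<psi>.\<phi>_add \<phi>.\<phi>_scalar \<psi>.\<phi>_scalar \<phi>.\<phi>_q0 \<psi>.\<phi>_q0 \<phi>.\<phi>_Qhat_neg1 \<psi>.\<phi>_Qhat_neg1
        right_diff_distrib)
qed

theorem theorem4p23:
  fixes scale :: "laurent_t \<Rightarrow> 'v::ab_group_add \<Rightarrow> 'v"
    and act :: "'v \<Rightarrow> qseries \<Rightarrow> 'v"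
    and bra :: "nat \<Rightarrow> 'v"
    and ket :: "nat \<Rightarrow> 'v \<Rightarrow> laurent_t"
    and p :: qseries and l :: nat
  assumes "cyclic_rep scale act bra ket"
    and "p \<in> A_plus"
  shows "mu l p = ket l (act (bra 0) p)"
proof -
  interpret cyclic_rep scale act bra ket by fact
  have "vacuum_functional (mu l)"
    unfolding mu_def by (rule vacuum_functional_CT)
  then interpret diff: vacuum_functional "\<lambda>x. mu l x - ket l (act (bra 0) x)"
    by (rule vacuum_functional_diff [OF _ vacuum_functional_ket])
  have "mu l p - ket l (act (bra 0) p) = 0"
    by (rule diff.vanishes_if_Qhat) (simp_all add: mu_Qhat ket_Qhat assms(2))
  then show ?thesis by simp
qed

end
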